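(* Let $(M,\omega)$ be a closed symplectically atoroidal manifold. Then $(M,\omega)$ does not admit any non-trivial symplectic $S^1$-action.
   Context: A symplectic manifold $(M,\omega)$ is called symplectically atoroidal if $\int_{T^2}f^*\omega=0$ for all smooth maps $f:T^2\to M$, where $T^2=S^1\times S^1$. A symplectic $S^1$-action on $(M,\omega)$ is a smooth action of the circle group $S^1$ on $M$ by diffeomorphisms preserving $\omega$. *)

theory Defs
  imports "HOL-Analysis.Analysis"
begin

section \<open>Smooth functions between normed spaces\<close>

text \<open>Classes \<open>C\<^sup>k\<close> and \<open>C\<^sup>\<infinity>\<close>, meant for open \<open>S\<close> only: derivatives are taken in the full
  neighbourhood of each point.\<close>

primrec Ck_on :: "nat \<Rightarrow> ('a::real_normed_vector \<Rightarrow> 'b::real_normed_vector) \<Rightarrow> 'a set \<Rightarrow> bool" where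
  "Ck_on 0 f S \<longleftrightarrow> continuous_on S f"
| "Ck_on (Suc k) f S \<longleftrightarrow>
     (\<forall>x\<in>S. f differentiable (at x)) \<and>
     (\<forall>v. Ck_on k (\<lambda>x. frechet_derivative f (at x) v) S)"

definition smooth_on :: "('a::real_normed_vector \<Rightarrow> 'b::real_normed_vector) \<Rightarrow> 'a set \<Rightarrow> bool" where
  "smooth_on f S \<longleftrightarrow> (\<forall>k. Ck_on k f S)"


section \<open>Smooth manifolds without boundary\<close>

text \<open>A chart is a pair \<open>(U, \<phi>)\<close> of a domain and a coordinate map; the values of \<open>\<phi>\<close>
  outside \<open>U\<close> are irrelevant. The inverse chart is \<open>inv_into U \<phi>\<close>.\<close>

type_synonym ('m, 'e) chart = "'m set \<times> ('m \<Rightarrow> 'e)"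

record ('m, 'e) manifold =
  mtop :: "'m topology"
  atlas :: "('m, 'e) chart set"

definition smooth_manifold :: "('m, 'e::euclidean_space) manifold \<Rightarrow> bool" where
  "smooth_manifold M \<longleftrightarrow>
     Hausdorff_space (mtop M) \<and> second_countable (mtop M) \<and>
     (\<Union>(U, \<phi>)\<in>atlas M. U) = topspace (mtop M) \<and>
     (\<forall>(U, \<phi>)\<in>atlas M. openin (mtop M) U \<and> open (\<phi> ` U) \<and>
        homeomorphic_map (subtopology (mtop M) U) (top_of_set (\<phi> ` U)) \<phi>) \<and>
     (\<forall>(U, \<phi>)\<in>atlas M. \<forall>(V, \<psi>)\<in>atlas M.
        smooth_on (\<psi> \<circ> inv_into U \<phi>) (\<phi> ` (U \<inter> V)))"

definition closed_manifold :: "('m, 'e::euclidean_space) manifold \<Rightarrow> bool" where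
  "closed_manifold M \<longleftrightarrow> smooth_manifold M \<and> compact_space (mtop M)"

definition smooth_map ::
  "('m, 'e::euclidean_space) manifold \<Rightarrow> ('n, 'f::euclidean_space) manifold \<Rightarrow> ('m \<Rightarrow> 'n) \<Rightarrow> bool" where
  "smooth_map M N f \<longleftrightarrow>
     continuous_map (mtop M) (mtop N) f \<and>
     (\<forall>(U, \<phi>)\<in>atlas M. \<forall>(V, \<psi>)\<in>atlas N.
        smooth_on (\<psi> \<circ> f \<circ> inv_into U \<phi>) (\<phi> ` (U \<inter> f -` V)))"

definition prod_manifold ::
  "('m, 'e) manifold \<Rightarrow> ('n, 'f) manifold \<Rightarrow> ('m \<times> 'n, 'e \<times> 'f) manifold" where
  "prod_manifold M N =
     \<lparr>mtop = prod_topology (mtop M) (mtop N),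
      atlas = {(U \<times> V, map_prod \<phi> \<psi>) | U \<phi> V \<psi>. (U, \<phi>) \<in> atlas M \<and> (V, \<psi>) \<in> atlas N}\<rparr>"

text \<open>The unit circle in \<open>\<complex>\<close>, with the angular coordinates on the complements of its points.\<close>

definition circle :: "(complex, real) manifold" where
  "circle =
     \<lparr>mtop = top_of_set (sphere 0 1),
      atlas = {(cis ` {a<..<a + 2 * pi}, inv_into {a<..<a + 2 * pi} cis) | a. True}\<rparr>"

definition torus :: "(complex \<times> complex, real \<times> real) manifold" where
  "torus = prod_manifold circle circle"


section \<open>Differential 2-forms\<close>

text \<open>A 2-form is given by its local representatives: \<open>\<omega> (U, \<phi>)\<close> is a 2-form on the open set
  \<open>\<phi> ` U\<close> of the model space, taking a point and two vectors. The last condition in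
  \<open>two_form_on\<close> says that representatives are pulled back to each other by the coordinate changes.\<close>

type_synonym ('m, 'e) two_form = "('m, 'e) chart \<Rightarrow> 'e \<Rightarrow> 'e \<Rightarrow> 'e \<Rightarrow> real"

definition two_form_on ::
  "('m, 'e::euclidean_space) manifold \<Rightarrow> ('m, 'e) two_form \<Rightarrow> bool" where
  "two_form_on M \<omega> \<longleftrightarrow>
     (\<forall>(U, \<phi>)\<in>atlas M.
        (\<forall>x\<in>\<phi> ` U. bilinear (\<omega> (U, \<phi>) x) \<and> (\<forall>v. \<omega> (U, \<phi>) x v v = 0)) \<and>
        (\<forall>v w. smooth_on (\<lambda>x. \<omega> (U, \<phi>) x v w) (\<phi> ` U))) \<and>
     (\<forall>(U, \<phi>)\<in>atlas M. \<forall>(V, \<psi>)\<in>atlas M. \<forall>x\<in>\<phi> ` (U \<inter> V). \<forall>v w.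
        let \<tau> = \<psi> \<circ> inv_into U \<phi>; D = frechet_derivative \<tau> (at x)
        in \<omega> (U, \<phi>) x v w = \<omega> (V, \<psi>) (\<tau> x) (D v) (D w))"

text \<open>Closedness is \<open>d\<omega> = 0\<close>, evaluated on constant vector fields of the model space, whose
  Lie brackets vanish.\<close>

definition closed_form ::
  "('m, 'e::euclidean_space) manifold \<Rightarrow> ('m, 'e) two_form \<Rightarrow> bool" where
  "closed_form M \<omega> \<longleftrightarrow>
     (\<forall>(U, \<phi>)\<in>atlas M. \<forall>x\<in>\<phi> ` U. \<forall>u v w.
        frechet_derivative (\<lambda>y. \<omega> (U, \<phi>) y v w) (at x) u
        - frechet_derivative (\<lambda>y. \<omega> (U, \<phi>) y u w) (at x) v
        + frechet_derivative (\<lambda>y. \<omega> (U, \<phi>) y u v) (at x) w = 0)"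

definition nondegenerate_form ::
  "('m, 'e::euclidean_space) manifold \<Rightarrow> ('m, 'e) two_form \<Rightarrow> bool" where
  "nondegenerate_form M \<omega> \<longleftrightarrow>
     (\<forall>(U, \<phi>)\<in>atlas M. \<forall>x\<in>\<phi> ` U. \<forall>v. v \<noteq> 0 \<longrightarrow> (\<exists>w. \<omega> (U, \<phi>) x v w \<noteq> 0))"

definition symplectic_manifold ::
  "('m, 'e::euclidean_space) manifold \<Rightarrow> ('m, 'e) two_form \<Rightarrow> bool" where
  "symplectic_manifold M \<omega> \<longleftrightarrow>
     smooth_manifold M \<and> two_form_on M \<omega> \<and> closed_form M \<omega> \<and> nondegenerate_form M \<omega>"

text \<open>The pullback \<open>f\<^sup>*\<omega>\<close> of a 2-form \<open>\<omega>\<close> on \<open>N\<close>, in the chart \<open>(U, \<phi>)\<close> of the source. By the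
  compatibility of the representatives of \<open>\<omega>\<close>, the chart of \<open>N\<close> chosen around the image point
  does not matter.\<close>

definition chart_at :: "('m, 'e) manifold \<Rightarrow> 'm \<Rightarrow> ('m, 'e) chart" where
  "chart_at M p = (SOME c. c \<in> atlas M \<and> p \<in> fst c)"

definition pullback ::
  "('n, 'f::euclidean_space) manifold \<Rightarrow> ('m \<Rightarrow> 'n) \<Rightarrow> ('n, 'f) two_form
     \<Rightarrow> ('m, 'e::euclidean_space) two_form" where
  "pullback N f \<omega> = (\<lambda>(U, \<phi>) x v w.
     let (V, \<psi>) = chart_at N (f (inv_into U \<phi> x));
         F = \<psi> \<circ> f \<circ> inv_into U \<phi>;
         D = frechet_derivative F (at x)
     in \<omega> (V, \<psi>) (F x) (D v) (D w))"

definition preserves_form ::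
  "('m, 'e::euclidean_space) manifold \<Rightarrow> ('m, 'e) two_form \<Rightarrow> ('m \<Rightarrow> 'm) \<Rightarrow> bool" where
  "preserves_form M \<omega> f \<longleftrightarrow>
     (\<forall>(U, \<phi>)\<in>atlas M. \<forall>x\<in>\<phi> ` U. \<forall>v w. pullback M f \<omega> (U, \<phi>) x v w = \<omega> (U, \<phi>) x v w)"

text \<open>The integral over \<open>T\<^sup>2\<close> is computed in the parametrization \<open>(s, t) \<mapsto> (e\<^sup>i\<^sup>s, e\<^sup>i\<^sup>t)\<close>, which is
  injective on \<open>[0, 2\<pi>)\<^sup>2\<close>; the chart \<open>(UNIV, id)\<close> is the global chart of \<open>\<real>\<^sup>2\<close>, and
  \<open>(1, 0)\<close>, \<open>(0, 1)\<close> are the coordinate vectors.\<close>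

definition torus_integral :: "(complex \<times> complex, real \<times> real) two_form \<Rightarrow> real" where
  "torus_integral \<eta> =
     integral (cbox (0, 0) (2 * pi, 2 * pi))
       (\<lambda>x. pullback torus (\<lambda>(s, t). (cis s, cis t)) \<eta> (UNIV, id) x (1, 0) (0, 1))"

definition symplectically_atoroidal ::
  "('m, 'e::euclidean_space) manifold \<Rightarrow> ('m, 'e) two_form \<Rightarrow> bool" where
  "symplectically_atoroidal M \<omega> \<longleftrightarrow>
     (\<forall>f. smooth_map torus M f \<longrightarrow> torus_integral (pullback M f \<omega>) = 0)"


section \<open>Circle actions\<close>

definition circle_action ::
  "('m, 'e::euclidean_space) manifold \<Rightarrow> (complex \<Rightarrow> 'm \<Rightarrow> 'm) \<Rightarrow> bool" where
  "circle_action M \<rho> \<longleftrightarrow>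
     smooth_map (prod_manifold circle M) M (\<lambda>(z, p). \<rho> z p) \<and>
     (\<forall>p\<in>topspace (mtop M). \<rho> 1 p = p) \<and>
     (\<forall>z\<in>sphere 0 1. \<forall>w\<in>sphere 0 1. \<forall>p\<in>topspace (mtop M). \<rho> (z * w) p = \<rho> z (\<rho> w p))"

text \<open>Each \<open>\<rho> z\<close> is a diffeomorphism, with inverse \<open>\<rho> (inverse z)\<close>.\<close>

definition symplectic_circle_action ::
  "('m, 'e::euclidean_space) manifold \<Rightarrow> ('m, 'e) two_form \<Rightarrow> (complex \<Rightarrow> 'm \<Rightarrow> 'm) \<Rightarrow> bool" where
  "symplectic_circle_action M \<omega> \<rho> \<longleftrightarrow>
     circle_action M \<rho> \<and> (\<forall>z\<in>sphere 0 1. preserves_form M \<omega> (\<rho> z))"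

definition trivial_action :: "('m, 'e) manifold \<Rightarrow> (complex \<Rightarrow> 'm \<Rightarrow> 'm) \<Rightarrow> bool" where
  "trivial_action M \<rho> \<longleftrightarrow> (\<forall>z\<in>sphere 0 1. \<forall>p\<in>topspace (mtop M). \<rho> z p = p)"

end

theory Submission imports Defs
begin

text \<open>Let \<open>\<xi>\<close> be the vector field generating the action and \<open>\<alpha> = \<iota>\<^sub>\<xi>\<omega>\<close>. For a loop \<open>\<gamma>\<close>, the torus
  \<open>(s, t) \<mapsto> e\<^sup>i\<^sup>s \<cdot> \<gamma>(t)\<close> has area \<open>2\<pi> \<integral>\<^sub>\<gamma> \<alpha>\<close>, so atoroidality gives \<open>\<alpha>\<close> a primitive \<open>H\<close> on each
  component. As \<open>M\<close> is compact, \<open>H\<close> attains a maximum and a minimum there; both are zeros of \<open>\<alpha>\<close>, hence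
  of \<open>\<xi>\<close>, hence fixed points. Let now \<open>\<gamma>\<close> be a path between two fixed points. Rotating \<open>\<gamma>\<close> on the way
  there and following it back without rotation is again a smooth torus, of area \<open>2\<pi> \<integral>\<^sub>\<gamma> \<alpha>\<close>, so
  \<open>H\<close> takes the same value at both. Therefore \<open>H\<close> is constant and \<open>\<xi> = 0\<close>. Paths are
  kept constant near their ends, so that all these concatenations are smooth.\<close>

section \<open>Calculus of smooth functions\<close>

text \<open>Neither \<xi> nor \<alpha> is defined on the manifold. Everything is read off maps g
  from Euclidean domains into it: the coefficient, at s = 0, of the pullback of \<omega> under (s,
  y) -> e^(is) g(y) in the directions d/ds and v is \<alpha> pulled back by g. Invariance of
  \<omega> makes this coefficient independent of s, so a double integral collapses to a single one.
  H(r) is the flux from a base point to r along any path, and loops having zero flux is what makes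
  it well defined. The set of points reached by such paths stands in for the component; its
  closedness makes it compact. The other obstacle is smoothness:
  \<open>symplectically_atoroidal\<close> quantifies over smooth maps out of the manifold
  \<open>torus\<close>, so each torus is built as a doubly periodic map of the plane, glued from
  pieces that agree on open overlaps. The resting ends of paths come from reparametrizing straight
  chart segments by a step function built from exp(-1/t).\<close>

lemma Ck_on_cong:
  assumes "open S" "Ck_on k f S" "\<And>x. x \<in> S \<Longrightarrow> f x = g x"
  shows "Ck_on k g S"
  using assms(2,3)
proof (induction k arbitrary: f g)
  case 0 then show ?case by (simp cong: continuous_on_cong)
next
  case (Suc k)
  have d: "(g has_derivative frechet_derivative f (at x)) (at x)" if x: "x \<in> S" for x
  proof (rule has_derivative_transform_within_open[OF _ \<open>open S\<close> x])
    show "(f has_derivative frechet_derivative f (at x)) (at x)"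
      using Suc.prems x by (simp add: frechet_derivative_works)
  qed (use Suc.prems in auto)
  show ?case
    unfolding Ck_on.simps
  proof (intro conjI ballI allI)
    fix v
    show "Ck_on k (\<lambda>x. frechet_derivative g (at x) v) S"
      by (rule Suc.IH[of "\<lambda>x. frechet_derivative f (at x) v"])
        (use Suc.prems in \<open>auto simp: frechet_derivative_at[OF d, symmetric]\<close>)
  qed (use d differentiable_def in blast)
qed

text \<open>The recursion is phrased with the chosen \<open>frechet_derivative\<close>; by
  uniqueness of derivatives, any explicitly known one may stand in for it.\<close>

lemma Ck_on_SucI:
  assumes "open S" and d: "\<And>x. x \<in> S \<Longrightarrow> (f has_derivative f' x) (at x)"
    and "\<And>v. Ck_on k (\<lambda>x. f' x v) S"
  shows "Ck_on (Suc k) f S"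
  unfolding Ck_on.simps
proof (intro conjI ballI allI)
  fix v
  show "Ck_on k (\<lambda>x. frechet_derivative f (at x) v) S"
    by (rule Ck_on_cong[OF assms(1) assms(3)[of v]]) (simp add: frechet_derivative_at[OF d, symmetric])
qed (use d differentiable_def in blast)

lemma Ck_on_SucD:
  assumes "Ck_on (Suc k) f S" "x \<in> S"
  shows "(f has_derivative frechet_derivative f (at x)) (at x)"
  using assms by (simp add: frechet_derivative_works)

lemma Ck_on_Suc_imp: "Ck_on (Suc k) f S \<Longrightarrow> Ck_on k f S"
proof (induction k arbitrary: f)
  case 0
  then show ?case by (simp add: differentiable_imp_continuous_within continuous_at_imp_continuous_on)
qed (subst Ck_on.simps, auto)

lemma Ck_on_subset: "Ck_on k f S \<Longrightarrow> T \<subseteq> S \<Longrightarrow> Ck_on k f T"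
  by (induction k arbitrary: f) (auto intro: continuous_on_subset)

text \<open>Derivatives are taken at x in the full space, so they do not depend on the set, and
  continuity is local on open sets.\<close>

lemma Ck_on_local:
  assumes "\<And>x. x \<in> S \<Longrightarrow> \<exists>N. open N \<and> x \<in> N \<and> Ck_on k f N"
  shows "Ck_on k f S"
  using assms
proof (induction k arbitrary: f)
  case 0
  then show ?case
    by (auto intro!: continuous_at_imp_continuous_on dest!: 0 simp: continuous_on_eq_continuous_at)
next
  case (Suc k)
  show ?case unfolding Ck_on.simps
  proof (intro conjI ballI allI)
    fix v show "Ck_on k (\<lambda>x. frechet_derivative f (at x) v) S"
      using Suc.prems by (intro Suc.IH) fastforce
  qed (use Suc.prems in fastforce)
qed

lemma Ck_on_const: "open S \<Longrightarrow> Ck_on k (\<lambda>x. c) S"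
proof (induction k arbitrary: c)
  case (Suc k)
  show ?case by (rule Ck_on_SucI[where f' = "\<lambda>_ _. 0"]) (use Suc in auto)
qed auto

lemma Ck_on_bounded_linear: "bounded_linear L \<Longrightarrow> open S \<Longrightarrow> Ck_on k L S"
proof (induction k)
  case 0 then show ?case by (simp add: linear_continuous_on)
next
  case (Suc k)
  show ?case
    by (rule Ck_on_SucI[where f' = "\<lambda>_. L"]) (use Suc in \<open>auto intro: Ck_on_const bounded_linear_imp_has_derivative\<close>)
qed

lemma Ck_on_add:
  assumes "open S" "Ck_on k f S" "Ck_on k g S"
  shows "Ck_on k (\<lambda>x. f x + g x) S"
  using assms(2,3)
proof (induction k arbitrary: f g)
  case (Suc k)
  show ?case
    by (rule Ck_on_SucI[OF assms(1) has_derivative_add[OF Ck_on_SucD Ck_on_SucD]])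
      (use Suc in auto)
qed (auto intro: continuous_on_add continuous_on_Pair)

lemma Ck_on_sum:
  assumes "open S" "finite I" "\<And>i. i \<in> I \<Longrightarrow> Ck_on k (f i) S"
  shows "Ck_on k (\<lambda>x. \<Sum>i\<in>I. f i x) S"
  using assms(2,3) by (induction I rule: finite_induct) (auto intro: Ck_on_const Ck_on_add assms(1))

lemma (in bounded_bilinear) Ck_on:
  assumes "open S" "Ck_on k f S" "Ck_on k g S"
  shows "Ck_on k (\<lambda>x. prod (f x) (g x)) S"
  using assms(2,3)
proof (induction k arbitrary: f g)
  case (Suc k)
  show ?case
  proof (rule Ck_on_SucI[OF assms(1) FDERIV[OF Ck_on_SucD Ck_on_SucD]])
    fix v
    show "Ck_on k (\<lambda>x. prod (f x) (frechet_derivative g (at x) v)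
        + prod (frechet_derivative f (at x) v) (g x)) S"
      using Suc.prems Ck_on_Suc_imp[OF Suc.prems(1)] Ck_on_Suc_imp[OF Suc.prems(2)]
      by (intro Ck_on_add Suc.IH assms(1)) auto
  qed (use Suc in auto)
qed (auto intro: continuous_on)

lemma Ck_on_Pair:
  assumes "open S" "Ck_on k f S" "Ck_on k g S"
  shows "Ck_on k (\<lambda>x. (f x, g x)) S"
  using assms(2,3)
proof (induction k arbitrary: f g)
  case (Suc k)
  show ?case
    by (rule Ck_on_SucI[OF assms(1) has_derivative_Pair[OF Ck_on_SucD Ck_on_SucD]])
      (use Suc in auto)
qed (auto intro: continuous_on_add continuous_on_Pair)

text \<open>Expanding \<open>Df(x)v\<close> in the basis reduces the derivative of a composition to products of functions of
  class \<open>C\<^sup>k\<close>, to which the induction hypothesis applies.\<close>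

lemma Ck_on_compose:
  fixes f :: "'a::real_normed_vector \<Rightarrow> 'b::euclidean_space" and g :: "'b \<Rightarrow> 'c::real_normed_vector"
  assumes "open S" "open T" "Ck_on k f S" "Ck_on k g T" "f ` S \<subseteq> T"
  shows "Ck_on k (\<lambda>x. g (f x)) S"
  using assms(3-5)
proof (induction k arbitrary: g)
  case 0
  then show ?case by (auto intro: continuous_on_compose2)
next
  case (Suc k)
  let ?D = "\<lambda>h x. frechet_derivative h (at x)"
  have lin: "linear (?D g y)" if "y \<in> T" for y
    using Ck_on_SucD[OF Suc.prems(2) that] by (simp add: has_derivative_linear)
  show ?case
  proof (rule Ck_on_SucI[where f' = "\<lambda>x v. \<Sum>b\<in>Basis. (?D f x v \<bullet> b) *\<^sub>R ?D g (f x) b", OF assms(1)])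
    fix x assume x: "x \<in> S"
    then have fx: "f x \<in> T" using Suc.prems by auto
    have 1: "((\<lambda>x. g (f x)) has_derivative (\<lambda>v. ?D g (f x) (?D f x v))) (at x)"
      by (rule has_derivative_compose[OF Ck_on_SucD[OF Suc.prems(1) x] Ck_on_SucD[OF Suc.prems(2) fx]])
    have 2: "?D g (f x) w = (\<Sum>b\<in>Basis. (w \<bullet> b) *\<^sub>R ?D g (f x) b)" for w
    proof -
      have "?D g (f x) (\<Sum>b\<in>Basis. (w \<bullet> b) *\<^sub>R b) = (\<Sum>b\<in>Basis. (w \<bullet> b) *\<^sub>R ?D g (f x) b)"
        by (simp only: linear_sum[OF lin[OF fx]] linear_cmul[OF lin[OF fx]])
      then show ?thesis by (simp only: euclidean_representation)
    qed
    show "((\<lambda>x. g (f x)) has_derivative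
        (\<lambda>v. \<Sum>b\<in>Basis. (?D f x v \<bullet> b) *\<^sub>R ?D g (f x) b)) (at x)"
      by (rule has_derivative_eq_rhs[OF 1]) (rule ext, rule 2)
  next
    fix v
    have "Ck_on k (\<lambda>x. (?D f x v \<bullet> b) *\<^sub>R ?D g (f x) b) S" for b
    proof (rule bounded_bilinear.Ck_on[OF bounded_bilinear_scaleR assms(1)])
      show "Ck_on k (\<lambda>x. ?D f x v \<bullet> b) S"
        using Suc.prems(1)
        by (intro bounded_bilinear.Ck_on[OF bounded_bilinear_inner assms(1)] Ck_on_const assms(1)) auto
      show "Ck_on k (\<lambda>x. ?D g (f x) b) S"
        using Suc.prems Ck_on_Suc_imp[OF Suc.prems(1)] by (intro Suc.IH) auto
    qed
    then show "Ck_on k (\<lambda>x. \<Sum>b\<in>Basis. (?D f x v \<bullet> b) *\<^sub>R ?D g (f x) b) S"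
      by (intro Ck_on_sum assms(1)) auto
  qed
qed

lemma smooth_on_cong:
  "open S \<Longrightarrow> smooth_on f S \<Longrightarrow> (\<And>x. x \<in> S \<Longrightarrow> f x = g x) \<Longrightarrow> smooth_on g S"
  unfolding smooth_on_def using Ck_on_cong by blast

lemma smooth_on_subset: "smooth_on f S \<Longrightarrow> T \<subseteq> S \<Longrightarrow> smooth_on f T"
  unfolding smooth_on_def using Ck_on_subset by blast

lemma smooth_on_local:
  "(\<And>x. x \<in> S \<Longrightarrow> \<exists>N. open N \<and> x \<in> N \<and> smooth_on f N) \<Longrightarrow> smooth_on f S"
  unfolding smooth_on_def by (intro allI Ck_on_local) blast

lemma smooth_on_const: "open S \<Longrightarrow> smooth_on (\<lambda>x. c) S"
  by (simp add: smooth_on_def Ck_on_const)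

lemma smooth_on_bounded_linear: "bounded_linear L \<Longrightarrow> open S \<Longrightarrow> smooth_on L S"
  by (simp add: smooth_on_def Ck_on_bounded_linear)

lemma smooth_on_add:
  "open S \<Longrightarrow> smooth_on f S \<Longrightarrow> smooth_on g S \<Longrightarrow> smooth_on (\<lambda>x. f x + g x) S"
  by (simp add: smooth_on_def Ck_on_add)

lemma smooth_on_scaleR:
  "open S \<Longrightarrow> smooth_on f S \<Longrightarrow> smooth_on g S \<Longrightarrow> smooth_on (\<lambda>x. f x *\<^sub>R g x) S"
  by (simp add: smooth_on_def bounded_bilinear.Ck_on[OF bounded_bilinear_scaleR])

lemma smooth_on_mult:
  fixes f g :: "_ \<Rightarrow> 'a::real_normed_algebra"
  shows "open S \<Longrightarrow> smooth_on f S \<Longrightarrow> smooth_on g S \<Longrightarrow> smooth_on (\<lambda>x. f x * g x) S"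
  by (simp add: smooth_on_def bounded_bilinear.Ck_on[OF bounded_bilinear_mult])

lemma smooth_on_Pair:
  "open S \<Longrightarrow> smooth_on f S \<Longrightarrow> smooth_on g S \<Longrightarrow> smooth_on (\<lambda>x. (f x, g x)) S"
  by (simp add: smooth_on_def Ck_on_Pair)

lemma smooth_on_compose:
  fixes f :: "_ \<Rightarrow> 'b::euclidean_space"
  shows "open S \<Longrightarrow> open T \<Longrightarrow> smooth_on f S \<Longrightarrow> smooth_on g T \<Longrightarrow> f ` S \<subseteq> T \<Longrightarrow>
    smooth_on (\<lambda>x. g (f x)) S"
  by (simp add: smooth_on_def Ck_on_compose)

lemma smooth_on_has_derivative:
  "smooth_on f S \<Longrightarrow> x \<in> S \<Longrightarrow> (f has_derivative frechet_derivative f (at x)) (at x)"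
  unfolding smooth_on_def using Ck_on_SucD by blast

lemma smooth_on_continuous_on: "smooth_on f S \<Longrightarrow> continuous_on S f"
  unfolding smooth_on_def using Ck_on.simps(1) by blast

lemma smooth_on_continuous_on_derivative:
  "smooth_on f S \<Longrightarrow> continuous_on S (\<lambda>x. frechet_derivative f (at x) v)"
  unfolding smooth_on_def using Ck_on.simps by blast

text \<open>The derivative v -> - x^-1 v x^-1 is a product of constants and two copies of the
  inverse itself, so the induction closes.\<close>

lemma smooth_on_inverse: "smooth_on (inverse :: 'a::real_normed_field \<Rightarrow> 'a) (- {0})"
  unfolding smooth_on_def
proof
  fix k
  have S: "open (- {0::'a})" by auto
  show "Ck_on k (inverse :: 'a \<Rightarrow> 'a) (- {0})"
  proof (induction k)
    case 0 show ?case by (auto intro!: continuous_intros)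
  next
    case (Suc k)
    have "Ck_on k (\<lambda>x::'a. (- 1) * (inverse x * v * inverse x)) (- {0})" for v
      by (intro bounded_bilinear.Ck_on[OF bounded_bilinear_mult] Ck_on_const S Suc)
    then show ?case
      by (intro Ck_on_SucI[where f' = "\<lambda>x v. - (inverse x * v * inverse x)"])
        (auto intro!: has_derivative_inverse' S)
  qed
qed

section \<open>A flat function and a smooth step\<close>

definition flat_exp :: "nat \<Rightarrow> real \<Rightarrow> real" where
  "flat_exp n t = (if t \<le> 0 then 0 else exp (- inverse t) * inverse t ^ n)"

lemma flat_exp_tendsto_0: "(flat_exp n \<longlongrightarrow> 0) (at 0)"
proof -
  have "((\<lambda>t. flat_exp n t) \<longlongrightarrow> 0) (at_right 0)"
  proof (rule Lim_transform_eventually)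
    have "((\<lambda>u::real. u ^ n / exp u) \<longlongrightarrow> 0) at_top" by (rule tendsto_power_div_exp_0)
    then show "((\<lambda>t::real. inverse t ^ n / exp (inverse t)) \<longlongrightarrow> 0) (at_right 0)"
      by (rule filterlim_compose[OF _ filterlim_inverse_at_top_right])
    show "\<forall>\<^sub>F t in at_right 0. inverse t ^ n / exp (inverse t) = flat_exp n t"
      by (auto simp: eventually_at_filter flat_exp_def exp_minus field_simps)
  qed
  moreover have "((\<lambda>t. flat_exp n t) \<longlongrightarrow> 0) (at_left 0)"
    by (rule Lim_transform_eventually[OF tendsto_const])
      (auto simp: eventually_at_filter flat_exp_def)
  ultimately show ?thesis by (simp add: filterlim_split_at)
qed

text \<open>The factors t^-n are carried along because the family is then closed under
  differentiation up to linear combinations, which is what the induction for smoothness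
  needs.\<close>

lemma flat_exp_has_derivative:
  "(flat_exp n has_real_derivative flat_exp (n + 2) t - real n * flat_exp (n + 1) t) (at t)"
proof -
  consider "t < 0" | "t = 0" | "t > 0" by linarith
  then show ?thesis
  proof cases
    case 1
    have "((\<lambda>_. 0) has_real_derivative 0) (at t)" by simp
    then have "(flat_exp n has_real_derivative 0) (at t)"
      by (rule has_field_derivative_transform_within_open[where S = "{..<0}"]) (use 1 in \<open>auto simp: flat_exp_def\<close>)
    then show ?thesis using 1 by (simp add: flat_exp_def)
  next
    case 2
    \<comment> \<open>At 0 the difference quotient of one member is the next member, whose limit is
      already known to be 0.\<close>
    have "(\<lambda>h. (flat_exp n (0 + h) - flat_exp n 0) / h) = flat_exp (Suc n)"
      by (auto simp: flat_exp_def field_simps)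
    then show ?thesis
      using flat_exp_tendsto_0[of "Suc n"] 2 by (simp add: DERIV_def) (simp add: flat_exp_def)
  next
    case 3
    have "((\<lambda>t. exp (- inverse t) * inverse t ^ n) has_real_derivative
        exp (- inverse t) * inverse t ^ (n + 2) - real n * (exp (- inverse t) * inverse t ^ (n + 1))) (at t)"
      by (rule DERIV_cong, use 3 in \<open>auto intro!: derivative_eq_intros\<close>)
        (cases n; simp add: algebra_simps power2_eq_square)
    then have "(flat_exp n has_real_derivative
        exp (- inverse t) * inverse t ^ (n + 2) - real n * (exp (- inverse t) * inverse t ^ (n + 1))) (at t)"
      by (rule has_field_derivative_transform_within_open[where S = "{0<..}"]) (use 3 in \<open>auto simp: flat_exp_def\<close>)
    then show ?thesis using 3 by (simp add: flat_exp_def)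
  qed
qed

lemma smooth_on_flat_exp: "smooth_on (flat_exp n) UNIV"
  unfolding smooth_on_def
proof
  fix k show "Ck_on k (flat_exp n) UNIV"
  proof (induction k arbitrary: n)
    case 0
    show ?case
      using DERIV_continuous_on[OF flat_exp_has_derivative] by simp
  next
    case (Suc k)
    let ?d = "\<lambda>x. flat_exp (n + 2) x + (- real n) * flat_exp (n + 1) x"
    have "(flat_exp n has_derivative (*) (?d x)) (at x)" for x
      using flat_exp_has_derivative[of n x] by (simp add: has_field_derivative_def)
    moreover have "Ck_on k (\<lambda>x. ?d x * v) UNIV" for v
      by (intro bounded_bilinear.Ck_on[OF bounded_bilinear_mult] Ck_on_add Ck_on_const open_UNIV Suc)
    ultimately show ?case
      by (intro Ck_on_SucI[where f' = "\<lambda>x. (*) (?d x)"]) auto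
  qed
qed

text \<open>The quotient e(t) / (e(t) + e(1 - t)) with e = \<open>flat_exp 0\<close> works: t and 1
  - t are never both nonpositive, so the denominator is positive.\<close>

lemma smooth_step:
  obtains b :: "real \<Rightarrow> real"
  where "smooth_on b UNIV" "\<And>t. t \<le> 0 \<Longrightarrow> b t = 0" "\<And>t. t \<ge> 1 \<Longrightarrow> b t = 1"
    "\<And>t. 0 \<le> b t" "\<And>t. b t \<le> 1"
proof
  let ?e = "flat_exp 0"
  define b where "b = (\<lambda>t. ?e t * inverse (?e t + ?e (1 - t)))"
  have nn: "?e t \<ge> 0" for t by (simp add: flat_exp_def)
  have pos: "?e t + ?e (1 - t) > 0" for t
    by (simp add: flat_exp_def add_pos_pos)
  have refl: "smooth_on (\<lambda>t. ?e (1 - t)) UNIV"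
  proof (rule smooth_on_compose[OF _ _ _ smooth_on_flat_exp])
    show "smooth_on (\<lambda>t::real. 1 - t) UNIV"
      using smooth_on_add[OF open_UNIV smooth_on_const[OF open_UNIV, of 1]
          smooth_on_bounded_linear[OF bounded_linear_minus[OF bounded_linear_ident] open_UNIV]]
      by simp
  qed auto
  show "smooth_on b UNIV"
    unfolding b_def
  proof (intro smooth_on_mult smooth_on_flat_exp open_UNIV)
    show "smooth_on (\<lambda>t. inverse (?e t + ?e (1 - t))) UNIV"
      by (rule smooth_on_compose[OF _ _ smooth_on_add[OF _ smooth_on_flat_exp refl] smooth_on_inverse])
        (use pos in \<open>auto simp: less_le\<close>)
  qed
  show "b t = 0" if "t \<le> 0" for t using that by (simp add: b_def flat_exp_def)
  show "b t = 1" if "t \<ge> 1" for t using that by (simp add: b_def flat_exp_def)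
  show "0 \<le> b t" for t using nn pos by (simp add: b_def less_imp_le)
  show "b t \<le> 1" for t using nn[of t] nn[of "1 - t"] pos[of t] by (simp add: b_def flip: divide_inverse)
qed

section \<open>Smooth maps from Euclidean spaces into a manifold\<close>

text \<open>One chart around each image point suffices, and N is required to be mapped into it.
  Continuity and smoothness in all other charts are then consequences, which keeps the condition
  easy to establish.\<close>

definition smooth_into ::
  "('m, 'e::euclidean_space) manifold \<Rightarrow> ('a::euclidean_space \<Rightarrow> 'm) \<Rightarrow> 'a set \<Rightarrow> bool" where
  "smooth_into M g S \<longleftrightarrow> open S \<and>
     (\<forall>x\<in>S. \<exists>(V, \<psi>)\<in>atlas M. \<exists>N. open N \<and> x \<in> N \<and> N \<subseteq> S \<and> g ` N \<subseteq> V \<and> smooth_on (\<psi> \<circ> g) N)"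

lemma smooth_intoI:
  assumes "open S"
    and "\<And>x. x \<in> S \<Longrightarrow> \<exists>V \<psi> N. (V, \<psi>) \<in> atlas M \<and> open N \<and> x \<in> N \<and> N \<subseteq> S \<and> g ` N \<subseteq> V \<and> smooth_on (\<psi> \<circ> g) N"
  shows "smooth_into M g S"
  unfolding smooth_into_def
proof (intro conjI ballI)
  fix x assume "x \<in> S"
  from assms(2)[OF this] obtain V \<psi> N where "(V, \<psi>) \<in> atlas M"
    "open N \<and> x \<in> N \<and> N \<subseteq> S \<and> g ` N \<subseteq> V \<and> smooth_on (\<psi> \<circ> g) N"
    by blast
  then show "\<exists>(V, \<psi>)\<in>atlas M. \<exists>N. open N \<and> x \<in> N \<and> N \<subseteq> S \<and> g ` N \<subseteq> V \<and> smooth_on (\<psi> \<circ> g) N"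
    by (intro bexI[of _ "(V, \<psi>)"]) auto
qed (rule assms(1))

lemma smooth_intoE:
  assumes "smooth_into M g S" "x \<in> S"
  obtains V \<psi> N where "(V, \<psi>) \<in> atlas M" "open N" "x \<in> N" "N \<subseteq> S" "g ` N \<subseteq> V" "smooth_on (\<psi> \<circ> g) N"
proof -
  obtain c where "c \<in> atlas M" "case c of (V, \<psi>) \<Rightarrow>
      \<exists>N. open N \<and> x \<in> N \<and> N \<subseteq> S \<and> g ` N \<subseteq> V \<and> smooth_on (\<psi> \<circ> g) N"
    using assms unfolding smooth_into_def by blast
  then show ?thesis using that by (cases c) auto
qed

lemma smooth_into_open: "smooth_into M g S \<Longrightarrow> open S"
  by (simp add: smooth_into_def)

text \<open>The gluing principle for maps defined by cases: near each point it is enough to agree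
  with some smooth map on an open set.\<close>

lemma smooth_into_local:
  assumes "open S" "\<And>x. x \<in> S \<Longrightarrow> \<exists>N g'. x \<in> N \<and> smooth_into M g' N \<and> (\<forall>y\<in>N. g y = g' y)"
  shows "smooth_into M g S"
proof (rule smooth_intoI[OF assms(1)])
  fix x assume x: "x \<in> S"
  from assms(2)[OF this] obtain N g' where N: "x \<in> N" "smooth_into M g' N" "\<And>y. y \<in> N \<Longrightarrow> g y = g' y"
    by blast
  obtain V \<psi> O' where V: "(V, \<psi>) \<in> atlas M" "open O'" "x \<in> O'" "O' \<subseteq> N" "g' ` O' \<subseteq> V" "smooth_on (\<psi> \<circ> g') O'"
    by (rule smooth_intoE[OF N(2,1)])
  have eq: "g y = g' y" if "y \<in> O'" for y using N(3) V(4) that by blast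
  have o: "open (O' \<inter> S)" using V(2) assms(1) by (rule open_Int)
  have "smooth_on (\<psi> \<circ> g') (O' \<inter> S)" by (rule smooth_on_subset[OF V(6)]) blast
  then have "smooth_on (\<psi> \<circ> g) (O' \<inter> S)"
    by (rule smooth_on_cong[OF o]) (simp add: eq)
  moreover have "g ` (O' \<inter> S) \<subseteq> V" using V(5) eq by auto
  ultimately show "\<exists>V \<psi> N. (V, \<psi>) \<in> atlas M \<and> open N \<and> x \<in> N \<and> N \<subseteq> S \<and> g ` N \<subseteq> V \<and> smooth_on (\<psi> \<circ> g) N"
    using V(1,3) x o by blast
qed

lemma smooth_into_compose:
  assumes "smooth_into M g T" "smooth_on h S" "open S" "h ` S \<subseteq> T"
  shows "smooth_into M (\<lambda>x. g (h x)) S"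
proof (rule smooth_intoI[OF assms(3)])
  fix x assume x: "x \<in> S"
  then have "h x \<in> T" using assms by auto
  then obtain V \<psi> N where V: "(V, \<psi>) \<in> atlas M" "open N" "h x \<in> N" "N \<subseteq> T" "g ` N \<subseteq> V" "smooth_on (\<psi> \<circ> g) N"
    by (rule smooth_intoE[OF assms(1)])
  let ?N = "S \<inter> h -` N"
  have o: "open ?N"
    by (rule continuous_open_preimage[OF smooth_on_continuous_on[OF assms(2)] assms(3) V(2)])
  have "smooth_on (\<lambda>x. (\<psi> \<circ> g) (h x)) ?N"
    by (rule smooth_on_compose[OF o V(2) smooth_on_subset[OF assms(2)] V(6)]) auto
  then show "\<exists>V \<psi> N. (V, \<psi>) \<in> atlas M \<and> open N \<and> x \<in> N \<and> N \<subseteq> S \<and> (\<lambda>x. g (h x)) ` N \<subseteq> V \<and> smooth_on (\<psi> \<circ> (\<lambda>x. g (h x))) N"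
    using V x o by (intro exI[of _ V] exI[of _ \<psi>] exI[of _ ?N] conjI) (simp_all add: o_def image_subset_iff)
qed

lemma smooth_into_subset:
  "smooth_into M g S \<Longrightarrow> open T \<Longrightarrow> T \<subseteq> S \<Longrightarrow> smooth_into M g T"
  using smooth_into_compose[of M g S "\<lambda>x. x" T] smooth_on_bounded_linear[OF bounded_linear_ident, of T] by simp

locale smooth_mfd =
  fixes M :: "('m, 'e::euclidean_space) manifold"
  assumes smooth_manifold: "smooth_manifold M"
begin

abbreviation X where "X \<equiv> topspace (mtop M)"

lemma chart:
  assumes "(U, \<phi>) \<in> atlas M"
  shows chart_openin: "openin (mtop M) U" and chart_open: "open (\<phi> ` U)"
    and chart_homeo: "homeomorphic_map (subtopology (mtop M) U) (top_of_set (\<phi> ` U)) \<phi>"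
    and chart_subset: "U \<subseteq> X"
  using smooth_manifold assms openin_subset unfolding smooth_manifold_def by auto

lemma chart_inj: "(U, \<phi>) \<in> atlas M \<Longrightarrow> inj_on \<phi> U"
  using homeomorphic_imp_injective_map[OF chart_homeo] chart_subset
  by (auto simp: topspace_subtopology Int_absorb1)

lemma chart_image_Int_mem: "(U, \<phi>) \<in> atlas M \<Longrightarrow> p \<in> U \<Longrightarrow> \<phi> p \<in> \<phi> ` (U \<inter> W) \<Longrightarrow> p \<in> W"
  using inj_on_image_mem_iff[OF chart_inj, of U \<phi> p "U \<inter> W"] by blast

lemma chart_inv_into: "(U, \<phi>) \<in> atlas M \<Longrightarrow> p \<in> U \<Longrightarrow> inv_into U \<phi> (\<phi> p) = p"
  using chart_inj by (simp add: inv_into_f_f)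

lemma chart_transition:
  "(U, \<phi>) \<in> atlas M \<Longrightarrow> (V, \<psi>) \<in> atlas M \<Longrightarrow> smooth_on (\<psi> \<circ> inv_into U \<phi>) (\<phi> ` (U \<inter> V))"
  using smooth_manifold unfolding smooth_manifold_def by fast

lemma chart_exists: "p \<in> X \<Longrightarrow> \<exists>U \<phi>. (U, \<phi>) \<in> atlas M \<and> p \<in> U"
  using smooth_manifold unfolding smooth_manifold_def by fast

lemma chart_open_image:
  assumes "(U, \<phi>) \<in> atlas M" "openin (mtop M) W" "W \<subseteq> U"
  shows "open (\<phi> ` W)"
proof -
  have "openin (subtopology (mtop M) U) W"
    using assms by (auto simp: openin_subtopology)
  then have "openin (top_of_set (\<phi> ` U)) (\<phi> ` W)"
    using homeomorphic_imp_open_map[OF chart_homeo[OF assms(1)]] by (simp add: open_map_def)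
  then show ?thesis using chart_open[OF assms(1)] by (rule openin_open_trans)
qed

lemma chart_open_image_Int:
  "(U, \<phi>) \<in> atlas M \<Longrightarrow> (V, \<psi>) \<in> atlas M \<Longrightarrow> open (\<phi> ` (U \<inter> V))"
  by (intro chart_open_image) (auto intro: chart_openin)

lemma continuous_map_chart_inv:
  assumes "(U, \<phi>) \<in> atlas M"
  shows "continuous_map (top_of_set (\<phi> ` U)) (mtop M) (inv_into U \<phi>)"
proof -
  obtain h where h: "homeomorphic_maps (subtopology (mtop M) U) (top_of_set (\<phi> ` U)) \<phi> h"
    using chart_homeo[OF assms] by (auto simp: homeomorphic_map_maps)
  have "continuous_map (top_of_set (\<phi> ` U)) (mtop M) h"
    using h by (auto simp: homeomorphic_maps_def continuous_map_in_subtopology)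
  then show ?thesis
    by (rule continuous_map_eq)
      (use h chart_inv_into[OF assms] chart_subset[OF assms] in \<open>auto simp: homeomorphic_maps_def topspace_subtopology\<close>)
qed

lemma smooth_into_chart_inv:
  assumes "(U, \<phi>) \<in> atlas M"
  shows "smooth_into M (inv_into U \<phi>) (\<phi> ` U)"
proof (rule smooth_intoI[OF chart_open[OF assms]])
  fix x assume "x \<in> \<phi> ` U"
  moreover have "smooth_on (\<phi> \<circ> inv_into U \<phi>) (\<phi> ` U)"
    using chart_transition[OF assms assms] by simp
  moreover have "inv_into U \<phi> ` \<phi> ` U \<subseteq> U" using chart_inv_into[OF assms] by auto
  ultimately show "\<exists>V \<psi> N. (V, \<psi>) \<in> atlas M \<and> open N \<and> x \<in> N \<and> N \<subseteq> \<phi> ` U \<and> inv_into U \<phi> ` N \<subseteq> V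
      \<and> smooth_on (\<psi> \<circ> inv_into U \<phi>) N"
    using assms chart_open[OF assms] by blast
qed

text \<open>The chart supplied by the definition is exchanged for the given one by a coordinate
  change, after shrinking N to where g lands in both domains.\<close>

lemma smooth_into_nhd:
  assumes "smooth_into M g S" "(V, \<psi>) \<in> atlas M" "x \<in> S" "g x \<in> V"
  obtains N where "open N" "x \<in> N" "N \<subseteq> S" "g ` N \<subseteq> V" "smooth_on (\<psi> \<circ> g) N"
proof -
  obtain W \<theta> N where W: "(W, \<theta>) \<in> atlas M" "open N" "x \<in> N" "N \<subseteq> S" "g ` N \<subseteq> W" "smooth_on (\<theta> \<circ> g) N"
    by (rule smooth_intoE[OF assms(1,3)])
  \<comment> \<open>As \<theta> is injective on W, landing in the image of W \<inter> V under
    \<theta> means that g itself lands in V; in coordinates this set is visibly open.\<close>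
  let ?N = "N \<inter> (\<theta> \<circ> g) -` (\<theta> ` (W \<inter> V))"
  have o: "open ?N"
    by (rule continuous_open_preimage[OF smooth_on_continuous_on[OF W(6)] W(2) chart_open_image_Int[OF W(1) assms(2)]])
  have gV: "g ` ?N \<subseteq> V"
    using W(5) chart_image_Int_mem[OF W(1)] by (fastforce simp: image_subset_iff)
  have "smooth_on (\<lambda>y. (\<psi> \<circ> inv_into W \<theta>) ((\<theta> \<circ> g) y)) ?N"
    by (rule smooth_on_compose[OF o chart_open_image_Int[OF W(1) assms(2)] smooth_on_subset[OF W(6)] chart_transition[OF W(1) assms(2)]])
      auto
  then have "smooth_on (\<psi> \<circ> g) ?N"
  proof (rule smooth_on_cong[OF o])
    fix y assume "y \<in> ?N"
    then have "g y \<in> W" using W(5) by blast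
    then show "(\<psi> \<circ> inv_into W \<theta>) ((\<theta> \<circ> g) y) = (\<psi> \<circ> g) y" by (simp add: chart_inv_into[OF W(1)])
  qed
  moreover have "x \<in> ?N" using W assms by auto
  ultimately show ?thesis using that[of ?N] o gV W(4) by auto
qed

lemma smooth_into_chart:
  assumes "smooth_into M g S" "(V, \<psi>) \<in> atlas M"
  shows "open (S \<inter> g -` V)" "smooth_on (\<psi> \<circ> g) (S \<inter> g -` V)"
proof -
  have *: "\<exists>N. open N \<and> x \<in> N \<and> N \<subseteq> S \<inter> g -` V \<and> smooth_on (\<psi> \<circ> g) N" if "x \<in> S \<inter> g -` V" for x
    using smooth_into_nhd[OF assms, of x] that by (metis IntE image_subset_iff_subset_vimage le_inf_iff vimage_eq)
  show "open (S \<inter> g -` V)" using * by (subst open_subopen) blast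
  show "smooth_on (\<psi> \<circ> g) (S \<inter> g -` V)" by (rule smooth_on_local) (use * in blast)
qed

lemma smooth_into_topspace:
  assumes "smooth_into M g S" "x \<in> S" shows "g x \<in> X"
  using smooth_intoE[OF assms] chart_subset by (metis image_subset_iff subsetD)

lemma smooth_into_continuous_map:
  assumes "smooth_into M g S"
  shows "continuous_map (top_of_set S) (mtop M) g"
proof -
  have "\<exists>N. openin (top_of_set S) N \<and> x \<in> N \<and> (\<forall>y\<in>N. g y \<in> O')"
    if O': "openin (mtop M) O'" "x \<in> S" "g x \<in> O'" for x O'
  proof -
    obtain W \<theta> N where W: "(W, \<theta>) \<in> atlas M" "open N" "x \<in> N" "N \<subseteq> S" "g ` N \<subseteq> W" "smooth_on (\<theta> \<circ> g) N"
      by (rule smooth_intoE[OF assms O'(2)])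
    let ?N = "N \<inter> (\<theta> \<circ> g) -` (\<theta> ` (W \<inter> O'))"
    have "open (\<theta> ` (W \<inter> O'))"
      by (rule chart_open_image[OF W(1)]) (use O' chart_openin[OF W(1)] in auto)
    then have "open ?N"
      by (rule continuous_open_preimage[OF smooth_on_continuous_on[OF W(6)] W(2)])
    moreover have "g ` ?N \<subseteq> O'"
      using W(5) chart_image_Int_mem[OF W(1)] by (fastforce simp: image_subset_iff)
    ultimately show ?thesis using W O' by (intro exI[of _ ?N]) (auto simp: openin_open_eq smooth_into_open[OF assms])
  qed
  then show ?thesis
    using smooth_into_topspace[OF assms]
    by (auto simp: continuous_map_eq_topcontinuous_at topcontinuous_at_def)
qed

end

section \<open>Pullbacks of a 2-form to Euclidean domains\<close>

locale mfd_two_form = smooth_mfd M for M :: "('m, 'e::euclidean_space) manifold" +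
  fixes \<omega> :: "('m, 'e) two_form"
  assumes two_form: "two_form_on M \<omega>"
begin

text \<open>With \<open>(UNIV, id)\<close> as chart of the source, the inverse chart is the
  identity, so this is the pullback of \<omega> by g on a Euclidean domain.\<close>

definition pb :: "('a::euclidean_space \<Rightarrow> 'm) \<Rightarrow> 'a \<Rightarrow> 'a \<Rightarrow> 'a \<Rightarrow> real" where
  "pb g = pullback M g \<omega> (UNIV, id)"

lemma bilinear_form: "(U, \<phi>) \<in> atlas M \<Longrightarrow> x \<in> \<phi> ` U \<Longrightarrow> bilinear (\<omega> (U, \<phi>) x)"
  and smooth_form: "(U, \<phi>) \<in> atlas M \<Longrightarrow> smooth_on (\<lambda>x. \<omega> (U, \<phi>) x v w) (\<phi> ` U)"
  using two_form unfolding two_form_on_def by blast+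

lemma form_transition:
  assumes "(U, \<phi>) \<in> atlas M" "(V, \<psi>) \<in> atlas M" "x \<in> \<phi> ` (U \<inter> V)"
  defines "\<tau> \<equiv> \<psi> \<circ> inv_into U \<phi>"
  shows "\<omega> (U, \<phi>) x v w =
    \<omega> (V, \<psi>) (\<tau> x) (frechet_derivative \<tau> (at x) v) (frechet_derivative \<tau> (at x) w)"
proof -
  have "\<forall>(U, \<phi>)\<in>atlas M. \<forall>(V, \<psi>)\<in>atlas M. \<forall>x\<in>\<phi> ` (U \<inter> V). \<forall>v w.
        let \<tau> = \<psi> \<circ> inv_into U \<phi>; D = frechet_derivative \<tau> (at x)
        in \<omega> (U, \<phi>) x v w = \<omega> (V, \<psi>) (\<tau> x) (D v) (D w)"
    using two_form unfolding two_form_on_def by (rule conjunct2)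
  from bspec[OF this assms(1)] have "\<forall>(V, \<psi>)\<in>atlas M. \<forall>x\<in>\<phi> ` (U \<inter> V). \<forall>v w.
        let \<tau> = \<psi> \<circ> inv_into U \<phi>; D = frechet_derivative \<tau> (at x)
        in \<omega> (U, \<phi>) x v w = \<omega> (V, \<psi>) (\<tau> x) (D v) (D w)" by simp
  from bspec[OF this assms(2)] have "\<forall>x\<in>\<phi> ` (U \<inter> V). \<forall>v w.
        let \<tau> = \<psi> \<circ> inv_into U \<phi>; D = frechet_derivative \<tau> (at x)
        in \<omega> (U, \<phi>) x v w = \<omega> (V, \<psi>) (\<tau> x) (D v) (D w)" by (simp only: prod.case)
  from bspec[OF this assms(3)] show ?thesis by (simp add: Let_def \<tau>_def)
qed

lemma chart_at: "p \<in> X \<Longrightarrow> chart_at M p \<in> atlas M \<and> p \<in> fst (chart_at M p)"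
proof -
  assume "p \<in> X"
  then obtain U \<phi> where "(U, \<phi>) \<in> atlas M" "p \<in> U" using chart_exists by blast
  then have "(U, \<phi>) \<in> atlas M \<and> p \<in> fst (U, \<phi>)" by simp
  then show ?thesis unfolding chart_at_def by (rule someI)
qed

lemma chart_atE:
  assumes "p \<in> X"
  obtains U \<phi> where "chart_at M p = (U, \<phi>)" "(U, \<phi>) \<in> atlas M" "p \<in> U"
  using chart_at[OF assms] that by (cases "chart_at M p") auto

lemma smooth_into_chart_has_derivative:
  assumes "smooth_into M g S" "x \<in> S" "(V, \<psi>) \<in> atlas M" "g x \<in> V"
  shows "((\<psi> \<circ> g) has_derivative frechet_derivative (\<psi> \<circ> g) (at x)) (at x)"
  using smooth_on_has_derivative[OF smooth_into_chart(2)[OF assms(1,3)]] assms by blast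

text \<open>\<^term>\<open>pb\<close> is defined through the arbitrary chart \<^term>\<open>chart_at M (g x)\<close>; the coordinate changes
  allow any other one.\<close>

lemma pb_chart:
  assumes g: "smooth_into M g S" and x: "x \<in> S" and V: "(V, \<psi>) \<in> atlas M" "g x \<in> V"
  defines "D \<equiv> frechet_derivative (\<psi> \<circ> g) (at x)"
  shows "pb g x v w = \<omega> (V, \<psi>) (\<psi> (g x)) (D v) (D w)"
proof -
  obtain U \<phi> where U: "chart_at M (g x) = (U, \<phi>)" "(U, \<phi>) \<in> atlas M" "g x \<in> U"
    using chart_atE[OF smooth_into_topspace[OF g x]] .
  let ?\<tau> = "\<psi> \<circ> inv_into U \<phi>"
  let ?E = "frechet_derivative (\<phi> \<circ> g) (at x)"
  have y: "\<phi> (g x) \<in> \<phi> ` (U \<inter> V)" using U V by blast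
  have dt: "(?\<tau> has_derivative frechet_derivative ?\<tau> (at (\<phi> (g x)))) (at ((\<phi> \<circ> g) x))"
    using smooth_on_has_derivative[OF chart_transition[OF U(2) V(1)] y] by simp
  obtain N where N: "open N" "x \<in> N" "g ` N \<subseteq> U"
    using smooth_into_nhd[OF g U(2) x U(3)] by metis
  have "((\<lambda>y. ?\<tau> ((\<phi> \<circ> g) y)) has_derivative
      (\<lambda>v. frechet_derivative ?\<tau> (at (\<phi> (g x))) (?E v))) (at x)"
    by (rule has_derivative_compose[OF smooth_into_chart_has_derivative[OF g x U(2,3)] dt])
  then have "((\<psi> \<circ> g) has_derivative (\<lambda>v. frechet_derivative ?\<tau> (at (\<phi> (g x))) (?E v))) (at x)"
  proof (rule has_derivative_transform_within_open[OF _ N(1,2)])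
    fix y assume "y \<in> N"
    then have "g y \<in> U" using N by blast
    then show "?\<tau> ((\<phi> \<circ> g) y) = (\<psi> \<circ> g) y" by (simp add: chart_inv_into[OF U(2)])
  qed
  then have "D = (\<lambda>v. frechet_derivative ?\<tau> (at (\<phi> (g x))) (?E v))"
    unfolding D_def by (rule frechet_derivative_at[symmetric])
  then show ?thesis
    using form_transition[OF U(2) V(1) y, of "?E v" "?E w"] chart_inv_into[OF U(2,3)]
    by (simp add: pb_def pullback_def U(1) o_def Let_def)
qed

text \<open>Only the germ at x matters: the images of x coincide, so the same chart is chosen, and
  the derivatives agree because N is open. Maps defined by cases are evaluated piecewise this
  way.\<close>

lemma pb_cong:
  assumes g: "smooth_into M g N" and x: "x \<in> N" and eq: "\<And>y. y \<in> N \<Longrightarrow> g y = g' y"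
  shows "pb g' x v w = pb g x v w"
proof -
  obtain U \<phi> where U: "chart_at M (g x) = (U, \<phi>)" "(U, \<phi>) \<in> atlas M" "g x \<in> U"
    using chart_atE[OF smooth_into_topspace[OF g x]] .
  have "((\<phi> \<circ> g') has_derivative frechet_derivative (\<phi> \<circ> g) (at x)) (at x)"
    by (rule has_derivative_transform_within_open[OF smooth_into_chart_has_derivative[OF g x U(2,3)] smooth_into_open[OF g] x])
      (simp add: eq)
  then have "frechet_derivative (\<phi> \<circ> g') (at x) = frechet_derivative (\<phi> \<circ> g) (at x)"
    by (rule frechet_derivative_at[symmetric])
  then show ?thesis
    using eq[OF x] U(1) by (simp add: pb_def pullback_def Let_def)
qed

text \<open>Both sides use the chart chosen at g (h x), so the chain rule alone suffices and h need
  only be differentiable at x.\<close>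

lemma pb_compose:
  assumes g: "smooth_into M g T" and h: "(h has_derivative h') (at x)" and x: "h x \<in> T"
  shows "pb (\<lambda>x. g (h x)) x v w = pb g (h x) (h' v) (h' w)"
proof -
  obtain U \<phi> where U: "chart_at M (g (h x)) = (U, \<phi>)" "(U, \<phi>) \<in> atlas M" "g (h x) \<in> U"
    using chart_atE[OF smooth_into_topspace[OF g x]] .
  have "((\<lambda>x. (\<phi> \<circ> g) (h x)) has_derivative (\<lambda>v. frechet_derivative (\<phi> \<circ> g) (at (h x)) (h' v))) (at x)"
    by (rule has_derivative_compose[OF h smooth_into_chart_has_derivative[OF g x U(2,3)]])
  then have "frechet_derivative (\<lambda>x. \<phi> (g (h x))) (at x) = (\<lambda>v. frechet_derivative (\<phi> \<circ> g) (at (h x)) (h' v))"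
    unfolding comp_def by (rule frechet_derivative_at[symmetric])
  then show ?thesis
    using U(1) by (simp add: pb_def pullback_def comp_def Let_def)
qed

lemma pb_bilinear:
  assumes g: "smooth_into M g S" and x: "x \<in> S"
  shows "bilinear (pb g x)"
proof -
  obtain U \<phi> where U: "(U, \<phi>) \<in> atlas M" "g x \<in> U"
    using chart_atE[OF smooth_into_topspace[OF g x]] by metis
  have lin: "linear (frechet_derivative (\<phi> \<circ> g) (at x))"
    using smooth_into_chart_has_derivative[OF g x U] by (rule has_derivative_linear)
  have b: "bilinear (\<omega> (U, \<phi>) (\<phi> (g x)))" using bilinear_form[OF U(1)] U(2) by blast
  have eq: "pb g x = (\<lambda>v w. \<omega> (U, \<phi>) (\<phi> (g x)) (frechet_derivative (\<phi> \<circ> g) (at x) v)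
      (frechet_derivative (\<phi> \<circ> g) (at x) w))"
    by (intro ext pb_chart[OF g x U])
  show ?thesis
    unfolding bilinear_def eq
  proof (intro conjI allI)
    fix v
    show "linear (\<lambda>w. \<omega> (U, \<phi>) (\<phi> (g x)) (frechet_derivative (\<phi> \<circ> g) (at x) v)
      (frechet_derivative (\<phi> \<circ> g) (at x) w))"
      using linear_compose[OF lin, of "\<omega> (U, \<phi>) (\<phi> (g x)) (frechet_derivative (\<phi> \<circ> g) (at x) v)"] b
      by (simp add: bilinear_def o_def)
    show "linear (\<lambda>w. \<omega> (U, \<phi>) (\<phi> (g x)) (frechet_derivative (\<phi> \<circ> g) (at x) w)
      (frechet_derivative (\<phi> \<circ> g) (at x) v))"
      using linear_compose[OF lin, of "\<lambda>w. \<omega> (U, \<phi>) (\<phi> (g x)) w (frechet_derivative (\<phi> \<circ> g) (at x) v)"] b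
      by (simp add: bilinear_def o_def)
  qed
qed

lemma pb_continuous_on:
  assumes g: "smooth_into M g S"
  shows "continuous_on S (\<lambda>x. pb g x v w)"
proof (rule continuous_at_imp_continuous_on, rule ballI)
  fix x assume x: "x \<in> S"
  obtain U \<phi> where U: "(U, \<phi>) \<in> atlas M" "g x \<in> U"
    using chart_atE[OF smooth_into_topspace[OF g x]] by metis
  obtain N where N: "open N" "x \<in> N" "N \<subseteq> S" "g ` N \<subseteq> U" "smooth_on (\<phi> \<circ> g) N"
    using smooth_into_nhd[OF g U(1) x U(2)] by metis
  let ?D = "\<lambda>y. frechet_derivative (\<phi> \<circ> g) (at y)"
  \<comment> \<open>\<open>smooth_form\<close> controls the coefficients for fixed vectors only,
    while here the vectors move with y; expanding both in the basis separates the two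
    dependences.\<close>
  let ?F = "\<lambda>y. \<Sum>(i, j)\<in>Basis \<times> Basis. (?D y v \<bullet> i) *\<^sub>R (?D y w \<bullet> j) *\<^sub>R \<omega> (U, \<phi>) (\<phi> (g y)) i j"
  have eq: "pb g y v w = ?F y" if "y \<in> N" for y
  proof -
    have y: "g y \<in> U" "y \<in> S" using N that by auto
    have "bilinear (\<omega> (U, \<phi>) (\<phi> (g y)))" using bilinear_form[OF U(1)] y by blast
    from bilinear_sum[OF this, of "\<lambda>i. (?D y v \<bullet> i) *\<^sub>R i" Basis "\<lambda>j. (?D y w \<bullet> j) *\<^sub>R j" Basis]
    show ?thesis
      using \<open>bilinear (\<omega> (U, \<phi>) (\<phi> (g y)))\<close> pb_chart[OF g y(2) U(1) y(1)]
      by (simp add: euclidean_representation bilinear_lmul bilinear_rmul mult.left_commute)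
  qed
  have "continuous_on N (\<lambda>y. \<omega> (U, \<phi>) (\<phi> (g y)) i j)" for i j
    by (rule continuous_on_compose2[OF smooth_on_continuous_on[OF smooth_form[OF U(1), of i j]]])
      (use N(4) smooth_on_continuous_on[OF N(5)] in \<open>auto simp: o_def\<close>)
  then have "continuous_on N ?F"
    unfolding case_prod_unfold
    by (intro continuous_on_sum continuous_on_scaleR continuous_on_inner continuous_on_const
        smooth_on_continuous_on_derivative[OF N(5)])
  then have "continuous_on N (\<lambda>x. pb g x v w)"
    by (rule continuous_on_eq) (simp add: eq)
  then show "isCont (\<lambda>x. pb g x v w) x"
    using N continuous_on_eq_continuous_at by blast
qed

text \<open>Pulling back by f after g is pulling back by f, then by g. Since
  \<open>preserves_form\<close> speaks of f in charts, g is first written locally as an inverse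
  chart after \<phi> \<circ> g.\<close>

lemma pb_preserves_form:
  assumes f: "preserves_form M \<omega> f"
    and sf: "\<And>U \<phi>. (U, \<phi>) \<in> atlas M \<Longrightarrow> smooth_into M (\<lambda>x. f (inv_into U \<phi> x)) (\<phi> ` U)"
    and g: "smooth_into M g S" and x: "x \<in> S"
  shows "pb (\<lambda>x. f (g x)) x v w = pb g x v w"
proof -
  obtain U \<phi> where U: "(U, \<phi>) \<in> atlas M" "g x \<in> U"
    using chart_atE[OF smooth_into_topspace[OF g x]] by metis
  obtain N where N: "open N" "x \<in> N" "N \<subseteq> S" "g ` N \<subseteq> U" "smooth_on (\<phi> \<circ> g) N"
    using smooth_into_nhd[OF g U(1) x U(2)] by metis
  let ?D = "frechet_derivative (\<phi> \<circ> g) (at x)"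
  let ?h = "\<lambda>y. f (inv_into U \<phi> ((\<phi> \<circ> g) y))"
  have "smooth_into M ?h N"
    by (rule smooth_into_compose[OF sf[OF U(1)] N(5,1)]) (use N(4) in auto)
  moreover have "?h y = f (g y)" if "y \<in> N" for y
  proof -
    have "g y \<in> U" using that N by blast
    then show ?thesis by (simp add: chart_inv_into[OF U(1)])
  qed
  ultimately have "pb (\<lambda>x. f (g x)) x v w = pb ?h x v w"
    by (intro pb_cong[OF _ N(2)])
  also have "\<dots> = pb (\<lambda>x. f (inv_into U \<phi> x)) ((\<phi> \<circ> g) x) (?D v) (?D w)"
    by (rule pb_compose[OF sf[OF U(1)] smooth_into_chart_has_derivative[OF g x U]]) (use U in auto)
  also have "\<dots> = pullback M f \<omega> (U, \<phi>) (\<phi> (g x)) (?D v) (?D w)"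
    by (simp add: pb_def pullback_def comp_def Let_def)
  also have "\<dots> = \<omega> (U, \<phi>) (\<phi> (g x)) (?D v) (?D w)"
    using f U unfolding preserves_form_def by blast
  also have "\<dots> = pb g x v w"
    by (rule pb_chart[OF g x U, symmetric])
  finally show ?thesis .
qed

end

section \<open>Circle actions\<close>

lemma cis_eq_iff: "cis s = cis t \<longleftrightarrow> (\<exists>n::int. s = t + 2 * pi * n)"
  using sin_cos_eq_iff[of s t] by (auto simp: complex_eq_iff)

lemma cis_periodic: "cis (s + 2 * pi * of_int n) = cis s"
  by (auto simp: cis_eq_iff)

lemma inj_on_cis: "inj_on cis {a<..<a + 2 * pi}"
proof (rule inj_onI)
  fix s t assume st: "s \<in> {a<..<a + 2 * pi}" "t \<in> {a<..<a + 2 * pi}" "cis s = cis t"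
  then obtain n :: int where n: "s = t + 2 * pi * n" by (auto simp: cis_eq_iff)
  have "2 * pi * \<bar>real_of_int n\<bar> = \<bar>s - t\<bar>" using n by (simp add: abs_mult)
  also have "\<dots> < 2 * pi * 1" using st by auto
  finally have "\<bar>real_of_int n\<bar> < 1" by simp
  then show "s = t" using n by simp
qed

abbreviation circle_chart :: "real \<Rightarrow> (complex, real) chart" where
  "circle_chart a \<equiv> (cis ` {a<..<a + 2 * pi}, inv_into {a<..<a + 2 * pi} cis)"

lemma circle_chart_atlas: "circle_chart a \<in> atlas circle"
  by (auto simp: circle_def)

lemma circle_chart_image: "inv_into {a<..<a + 2 * pi} cis ` cis ` {a<..<a + 2 * pi} = {a<..<a + 2 * pi}"
  by (simp add: image_image inv_into_f_f[OF inj_on_cis])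

lemma circle_chart_inv: 
  "s \<in> {a<..<a + 2 * pi} \<Longrightarrow> inv_into (cis ` {a<..<a + 2 * pi}) (inv_into {a<..<a + 2 * pi} cis) s = cis s"
  by (rule inv_into_f_eq[OF inj_on_inv_into[OF subset_refl] imageI inv_into_f_f[OF inj_on_cis]])

lemma inv_into_map_prod:
  assumes "inj_on f A" "inj_on g B" "x \<in> f ` A" "y \<in> g ` B"
  shows "inv_into (A \<times> B) (map_prod f g) (x, y) = (inv_into A f x, inv_into B g y)"
  using assms by (intro inv_into_f_eq map_prod_inj_on) (auto simp: inv_into_into f_inv_into_f)

locale circle_mfd = smooth_mfd M for M :: "('m, 'e::euclidean_space) manifold" +
  fixes \<rho> :: "complex \<Rightarrow> 'm \<Rightarrow> 'm"
  assumes action: "circle_action M \<rho>"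
begin

lemma action_one: "p \<in> X \<Longrightarrow> \<rho> 1 p = p"
  and action_mult: "p \<in> X \<Longrightarrow> \<rho> (cis s) (\<rho> (cis t) p) = \<rho> (cis (s + t)) p"
  using action unfolding circle_action_def by (auto simp: cis_mult[symmetric])

text \<open>Angular charts see only intervals of length 2 pi. Here the angle becomes a real
  variable, so that later arguments need no product charts of
  \<open>prod_manifold circle M\<close>.\<close>

lemma action_smooth_into_chart:
  assumes U: "(U, \<phi>) \<in> atlas M"
  shows "smooth_into M (\<lambda>(s, x). \<rho> (cis s) (inv_into U \<phi> x)) (UNIV \<times> \<phi> ` U)"
proof (rule smooth_intoI)
  show "open ((UNIV::real set) \<times> \<phi> ` U)" by (intro open_Times open_UNIV chart_open[OF U])
next
  fix p :: "real \<times> 'e" assume p: "p \<in> UNIV \<times> \<phi> ` U"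
  obtain s0 x0 where p_eq: "p = (s0, x0)" by (cases p)
  have x0: "x0 \<in> \<phi> ` U" using p p_eq by auto
  let ?r = "\<lambda>(z, q). \<rho> z q"
  let ?R = "\<lambda>(s, x). \<rho> (cis s) (inv_into U \<phi> x)"
  \<comment> \<open>The angular chart is centred at the given angle s0, so every real angle is
    covered.\<close>
  let ?I = "{s0 - pi<..<s0 - pi + 2 * pi}"
  let ?A = "cis ` ?I" and ?\<alpha> = "inv_into ?I cis"
  have sm: "smooth_map (prod_manifold circle M) M ?r"
    using action by (simp add: circle_action_def)
  then have cont: "continuous_map (prod_topology (top_of_set (sphere 0 1)) (mtop M)) (mtop M) ?r"
    by (simp add: smooth_map_def prod_manifold_def circle_def)
  \<comment> \<open>Continuity is extracted separately to know that the points sent into V form an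
    open set.\<close>
  have cR: "continuous_map (top_of_set (?I \<times> \<phi> ` U)) (mtop M) ?R"
  proof -
    have "continuous_map (top_of_set (?I \<times> \<phi> ` U)) (top_of_set (sphere 0 1)) (\<lambda>y. cis (fst y))"
      by (auto simp: continuous_map_in_subtopology intro!: continuous_intros)
    moreover have "continuous_map (top_of_set (?I \<times> \<phi> ` U)) (top_of_set (\<phi> ` U)) snd"
      by (auto simp: continuous_map_in_subtopology intro!: continuous_intros)
    then have "continuous_map (top_of_set (?I \<times> \<phi> ` U)) (mtop M) (inv_into U \<phi> \<circ> snd)"
      using continuous_map_chart_inv[OF U] by (rule continuous_map_compose)
    ultimately have "continuous_map (top_of_set (?I \<times> \<phi> ` U)) (prod_topology (top_of_set (sphere 0 1)) (mtop M))
        (\<lambda>y. (cis (fst y), (inv_into U \<phi> \<circ> snd) y))"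
      by (rule continuous_map_pairedI)
    from continuous_map_compose[OF this cont] show ?thesis
      by (simp add: o_def case_prod_unfold)
  qed
  have pin: "p \<in> ?I \<times> \<phi> ` U" using x0 p_eq by auto
  then have "?R p \<in> ?R ` topspace (top_of_set (?I \<times> \<phi> ` U))" by (intro imageI) simp
  then have "?R p \<in> X" using continuous_map_image_subset_topspace[OF cR] by blast
  then obtain V \<psi> where V: "(V, \<psi>) \<in> atlas M" "?R p \<in> V" using chart_exists by blast
  let ?D = "{y \<in> ?I \<times> \<phi> ` U. ?R y \<in> V}"
  have "openin (top_of_set (?I \<times> \<phi> ` U)) ?D"
    using openin_continuous_map_preimage[OF cR chart_openin[OF V(1)]] by (simp add: topspace_subtopology)
  then have oD: "open ?D"
    by (rule openin_open_trans) (intro open_Times open_greaterThanLessThan chart_open[OF U])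
  let ?c = "(?A \<times> U, map_prod ?\<alpha> \<phi>)"
  have "?c \<in> atlas (prod_manifold circle M)"
  proof -
    from circle_chart_atlas[of "s0 - pi"] U
    show ?thesis unfolding prod_manifold_def manifold.simps by blast
  qed
  then have sm2: "smooth_on (\<psi> \<circ> ?r \<circ> inv_into (?A \<times> U) (map_prod ?\<alpha> \<phi>))
      (map_prod ?\<alpha> \<phi> ` ((?A \<times> U) \<inter> ?r -` V))"
    using sm V(1) unfolding smooth_map_def by (blast dest: bspec)
  have inv: "inv_into (?A \<times> U) (map_prod ?\<alpha> \<phi>) (s, x) = (cis s, inv_into U \<phi> x)"
    if "s \<in> ?I" "x \<in> \<phi> ` U" for s x
    using that circle_chart_image[of "s0 - pi"] circle_chart_inv[of s "s0 - pi"]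
    by (subst inv_into_map_prod[OF inj_on_inv_into[OF subset_refl] chart_inj[OF U]]) auto
  have sub: "?D \<subseteq> map_prod ?\<alpha> \<phi> ` ((?A \<times> U) \<inter> ?r -` V)"
  proof
    fix y assume y: "y \<in> ?D"
    obtain s x where sx: "y = (s, x)" by (cases y)
    have s: "s \<in> ?I" and x: "x \<in> \<phi> ` U" and V': "\<rho> (cis s) (inv_into U \<phi> x) \<in> V" using y sx by auto
    have "(cis s, inv_into U \<phi> x) \<in> (?A \<times> U) \<inter> ?r -` V"
      using imageI[OF s, of cis] inv_into_into[OF x] V' by simp
    moreover have "y = map_prod ?\<alpha> \<phi> (cis s, inv_into U \<phi> x)"
      using inv_into_f_f[OF inj_on_cis s] f_inv_into_f[OF x] sx by simp
    ultimately show "y \<in> map_prod ?\<alpha> \<phi> ` ((?A \<times> U) \<inter> ?r -` V)" by blast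
  qed
  have "smooth_on (\<psi> \<circ> ?R) ?D"
  proof (rule smooth_on_cong[OF oD smooth_on_subset[OF sm2 sub]])
    fix y assume y: "y \<in> ?D"
    obtain s x where sx: "y = (s, x)" by (cases y)
    show "(\<psi> \<circ> ?r \<circ> inv_into (?A \<times> U) (map_prod ?\<alpha> \<phi>)) y = (\<psi> \<circ> ?R) y"
      using inv[of s x] y sx by simp
  qed
  moreover have "?R ` ?D \<subseteq> V" by blast
  moreover have "p \<in> ?D" using pin V(2) by blast
  moreover have "?D \<subseteq> UNIV \<times> \<phi> ` U" by blast
  ultimately show "\<exists>V \<psi> N. (V, \<psi>) \<in> atlas M \<and> open N \<and> p \<in> N \<and> N \<subseteq> UNIV \<times> \<phi> ` U \<and> ?R ` N \<subseteq> V \<and> smooth_on (\<psi> \<circ> ?R) N"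
    using V(1) oD by blast
qed

text \<open>The angle may vary with the point: a constant \<sigma> gives a single diffeomorphism,
  the identity an orbit, and a coordinate projection the map \<open>sweep\<close>.\<close>

lemma action_smooth_into:
  assumes g: "smooth_into M g S" and \<sigma>: "smooth_on \<sigma> S"
  shows "smooth_into M (\<lambda>x. \<rho> (cis (\<sigma> x)) (g x)) S"
proof (rule smooth_into_local[OF smooth_into_open[OF g]])
  fix x assume x: "x \<in> S"
  obtain U \<phi> N where U: "(U, \<phi>) \<in> atlas M" "open N" "x \<in> N" "N \<subseteq> S" "g ` N \<subseteq> U" "smooth_on (\<phi> \<circ> g) N"
    by (rule smooth_intoE[OF g x])
  let ?h = "\<lambda>y. (\<lambda>(s, x). \<rho> (cis s) (inv_into U \<phi> x)) (\<sigma> y, (\<phi> \<circ> g) y)"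
  have "smooth_into M ?h N"
    by (rule smooth_into_compose[OF action_smooth_into_chart[OF U(1)]
          smooth_on_Pair[OF U(2) smooth_on_subset[OF \<sigma> U(4)] U(6)] U(2)]) (use U(5) in auto)
  moreover have "\<rho> (cis (\<sigma> y)) (g y) = ?h y" if "y \<in> N" for y
  proof -
    have "g y \<in> U" using that U by blast
    then show ?thesis by (simp add: chart_inv_into[OF U(1)])
  qed
  ultimately show "\<exists>N g'. x \<in> N \<and> smooth_into M g' N \<and> (\<forall>y\<in>N. \<rho> (cis (\<sigma> y)) (g y) = g' y)"
    using U(3) by blast
qed

end

section \<open>Tori\<close>

lemma torus_atlasE:
  assumes "c \<in> atlas torus"
  obtains a b where "c = (cis ` {a<..<a + 2 * pi} \<times> cis ` {b<..<b + 2 * pi},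
    map_prod (inv_into {a<..<a + 2 * pi} cis) (inv_into {b<..<b + 2 * pi} cis))"
  using assms unfolding torus_def prod_manifold_def circle_def by auto

lemma torus_chart_inv:
  assumes "s \<in> {a<..<a + 2 * pi}" "t \<in> {b<..<b + 2 * pi}"
  shows "inv_into (cis ` {a<..<a + 2 * pi} \<times> cis ` {b<..<b + 2 * pi})
      (map_prod (inv_into {a<..<a + 2 * pi} cis) (inv_into {b<..<b + 2 * pi} cis)) (s, t) = (cis s, cis t)"
  using assms by (subst inv_into_map_prod) (simp_all only: inj_on_inv_into subset_refl circle_chart_image circle_chart_inv)

lemma mtop_torus: "mtop torus = top_of_set (sphere 0 1 \<times> sphere 0 1)"
  by (simp add: torus_def prod_manifold_def circle_def subtopology_Times[symmetric])

lemma torus_chart_exists: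
  "\<exists>c. c \<in> atlas torus \<and> (cis s, cis t) \<in> fst c"
proof -
  let ?a = "s - pi" and ?b = "t - pi"
  have "circle_chart ?a \<in> atlas circle" "circle_chart ?b \<in> atlas circle"
    by (rule circle_chart_atlas)+
  then have "(cis ` {?a<..<?a + 2 * pi} \<times> cis ` {?b<..<?b + 2 * pi},
    map_prod (inv_into {?a<..<?a + 2 * pi} cis) (inv_into {?b<..<?b + 2 * pi} cis)) \<in> atlas torus"
    unfolding torus_def prod_manifold_def manifold.simps by blast
  then show ?thesis by (intro exI conjI) auto
qed

text \<open>The tori below are written as maps of the plane; this locale makes them smooth maps on
  \<open>torus\<close> and identifies the integral.\<close>

locale doubly_periodic = mfd_two_form M \<omega> for M :: "('m, 'e::euclidean_space) manifold" and \<omega> +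
  fixes G :: "real \<times> real \<Rightarrow> 'm"
  assumes G: "smooth_into M G UNIV"
    and per1: "\<And>s t n. G (s + 2 * pi * of_int n, t) = G (s, t)"
    and per2: "\<And>s t n. G (s, t + 2 * pi * of_int n) = G (s, t)"
begin

text \<open>The branch of \<open>Arg\<close> is immaterial, because two arguments of a number differ
  by a multiple of 2 pi and G is periodic.\<close>

definition torus_map :: "complex \<times> complex \<Rightarrow> 'm" where
  "torus_map = (\<lambda>(z, w). G (Arg z, Arg w))"

lemma torus_map_cis: "torus_map (cis s, cis t) = G (s, t)"
proof -
  have "cis (Arg (cis u)) = cis u" for u by (simp add: cis_Arg)
  then obtain k l where "Arg (cis s) = s + 2 * pi * of_int k" "Arg (cis t) = t + 2 * pi * of_int l"
    unfolding cis_eq_iff by metis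
  then show ?thesis by (simp add: torus_map_def per1 per2)
qed

lemma torus_map_continuous: "continuous_map (mtop torus) (mtop M) torus_map"
proof -
  let ?T = "sphere (0::complex) 1 \<times> sphere (0::complex) 1"
  have cis_ex: "\<exists>a. z = cis a" if "z \<in> sphere 0 1" for z :: complex
  proof -
    have "norm z = 1" using that by simp
    then have "z \<noteq> 0" by auto
    then have "z = cis (Arg z)" using cis_Arg[of z] \<open>norm z = 1\<close> by (simp add: sgn_eq)
    then show ?thesis by blast
  qed
  have cis2_ex: "\<exists>a b. p = (cis a, cis b)" if "p \<in> ?T" for p
    using cis_ex[of "fst p"] cis_ex[of "snd p"] that by (cases p) auto
  have nhd: "\<exists>N. open N \<and> p \<in> N \<and> (\<forall>q\<in>N \<inter> ?T. torus_map q \<in> W)"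
    if W: "openin (mtop M) W" and p: "p \<in> ?T" "torus_map p \<in> W" for p W
  proof -
    obtain a b where ab: "p = (cis a, cis b)" using cis2_ex[OF p(1)] by blast
    \<comment> \<open>\<open>Arg\<close> jumps at its cut. Dividing by cis a moves the point to 1,
      where \<open>Arg\<close> is continuous, and adding a back gives a continuous choice of angles
      near p that G cannot distinguish from \<open>Arg\<close>.\<close>
    define h where "h = (\<lambda>q. (a + Arg (fst q / cis a), b + Arg (snd q / cis b)))"
    have op: "open {y. G y \<in> W}"
      using openin_continuous_map_preimage[OF smooth_into_continuous_map[OF G] W] by simp
    have "isCont (\<lambda>q. fst q / cis a) p" "isCont (\<lambda>q. snd q / cis b) p"
      by (auto intro!: continuous_intros)
    moreover have "isCont Arg (fst p / cis a)" "isCont Arg (snd p / cis b)"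
      using ab by (auto intro!: continuous_at_Arg)
    ultimately have "isCont (\<lambda>q. Arg (fst q / cis a)) p" "isCont (\<lambda>q. Arg (snd q / cis b)) p"
      by (auto intro: isCont_o2[where g = Arg])
    then have "isCont h p"
      unfolding h_def by (intro continuous_Pair continuous_add continuous_const)
    moreover have "h p = (a, b)" using ab by (simp add: h_def)
    moreover have "G (a, b) \<in> W" using p(2) ab by (simp add: torus_map_cis)
    ultimately obtain N where N: "open N" "p \<in> N" "\<forall>q\<in>N. h q \<in> {y. G y \<in> W}"
      using op unfolding continuous_at_open by (metis mem_Collect_eq)
    moreover have "torus_map q = G (h q)" if q: "q \<in> ?T" for q
    proof -
      obtain s t where st: "q = (cis s, cis t)" using cis2_ex[OF q] by blast
      have *: "cis (u + Arg (cis v / cis u)) = cis v" for u v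
        by (simp add: cis_mult[symmetric] cis_Arg cis_divide del: cis_mult) (simp add: cis_mult)
      have "q = (cis (fst (h q)), cis (snd (h q)))" by (simp add: h_def st *)
      then show ?thesis by (metis torus_map_cis prod.collapse)
    qed
    ultimately show ?thesis by (intro exI[of _ N]) auto
  qed
  have "torus_map p \<in> X" for p
    using smooth_into_topspace[OF G] by (simp add: torus_map_def case_prod_unfold)
  moreover have "openin (top_of_set ?T) {p \<in> ?T. torus_map p \<in> W}" if W: "openin (mtop M) W" for W
  proof (subst openin_subopen, rule ballI)
    fix p assume p: "p \<in> {p \<in> ?T. torus_map p \<in> W}"
    then obtain N where N: "open N" "p \<in> N" "\<forall>q\<in>N \<inter> ?T. torus_map q \<in> W"
      using nhd[OF W, of p] by blast
    show "\<exists>N. openin (top_of_set ?T) N \<and> p \<in> N \<and> N \<subseteq> {p \<in> ?T. torus_map p \<in> W}"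
      using N p by (intro exI[of _ "?T \<inter> N"]) (auto simp: openin_open_Int)
  qed
  ultimately show ?thesis
    unfolding mtop_torus continuous_map_def by (simp add: Pi_iff)
qed

text \<open>In a pair of angular coordinates the map is G restricted to an open rectangle.\<close>

lemma torus_map_smooth: "smooth_map torus M torus_map"
  unfolding smooth_map_def
proof (intro conjI ballI torus_map_continuous)
  fix c assume c: "c \<in> atlas torus"
  obtain a b where ab: "c = (cis ` {a<..<a + 2 * pi} \<times> cis ` {b<..<b + 2 * pi},
    map_prod (inv_into {a<..<a + 2 * pi} cis) (inv_into {b<..<b + 2 * pi} cis))"
    using torus_atlasE[OF c] .
  let ?I = "{a<..<a + 2 * pi}" and ?J = "{b<..<b + 2 * pi}"
  let ?A = "cis ` ?I \<times> cis ` ?J" and ?\<kappa> = "map_prod (inv_into ?I cis) (inv_into ?J cis)"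
  show "case c of (U, \<phi>) \<Rightarrow> \<forall>(V, \<psi>)\<in>atlas M.
      smooth_on (\<psi> \<circ> torus_map \<circ> inv_into U \<phi>) (\<phi> ` (U \<inter> torus_map -` V))"
    unfolding ab prod.case
  proof (rule ballI)
    fix d assume d: "d \<in> atlas M"
    obtain W \<psi> where W: "d = (W, \<psi>)" by (cases d)
    have Wa: "(W, \<psi>) \<in> atlas M" using d W by simp
    let ?D = "(?I \<times> ?J) \<inter> (UNIV \<inter> G -` W)"
    have set: "?\<kappa> ` (?A \<inter> torus_map -` W) = ?D"
    proof (intro equalityI subsetI)
      fix y assume "y \<in> ?\<kappa> ` (?A \<inter> torus_map -` W)"
      then obtain p where p: "y = ?\<kappa> p" "p \<in> ?A \<inter> torus_map -` W" by (rule imageE)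
      from IntD1[OF p(2)] obtain z w where zw: "p = (z, w)" "z \<in> cis ` ?I" "w \<in> cis ` ?J" by (rule SigmaE)
      from zw(2) obtain s where s: "z = cis s" "s \<in> ?I" by (rule imageE)
      from zw(3) obtain t where t: "w = cis t" "t \<in> ?J" by (rule imageE)
      from p zw(1) s t show "y \<in> ?D" by (simp add: inv_into_f_f[OF inj_on_cis] torus_map_cis)
    next
      fix y assume y: "y \<in> ?D"
      obtain s t where st: "y = (s, t)" by (cases y)
      have "(cis s, cis t) \<in> ?A \<inter> torus_map -` W" "y = ?\<kappa> (cis s, cis t)"
        using y st by (auto simp: inv_into_f_f[OF inj_on_cis] torus_map_cis)
      then show "y \<in> ?\<kappa> ` (?A \<inter> torus_map -` W)" by (rule rev_image_eqI)
    qed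
    have "open ?D"
      by (intro open_Int[OF open_Times smooth_into_chart(1)[OF G Wa]] open_greaterThanLessThan)
    moreover have "smooth_on (\<psi> \<circ> G) ?D"
      by (rule smooth_on_subset[OF smooth_into_chart(2)[OF G Wa]]) blast
    ultimately have "smooth_on (\<psi> \<circ> torus_map \<circ> inv_into ?A ?\<kappa>) ?D"
    proof (rule smooth_on_cong)
      fix y assume y: "y \<in> ?D"
      obtain s t where st: "y = (s, t)" by (cases y)
      show "(\<psi> \<circ> G) y = (\<psi> \<circ> torus_map \<circ> inv_into ?A ?\<kappa>) y"
        using y unfolding st comp_def by (subst torus_chart_inv) (simp_all add: torus_map_cis)
    qed
    then show "case d of (V, \<psi>) \<Rightarrow> smooth_on (\<psi> \<circ> torus_map \<circ> inv_into ?A ?\<kappa>) (?\<kappa> ` (?A \<inter> torus_map -` V))"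
      by (simp only: W prod.case set)
  qed
qed

text \<open>\<open>torus_integral\<close> goes through an unspecified pair of angular charts. Near x
  the parametrization reads y -> y + d in them, where d consists of the multiples of 2 pi that move
  x into the chosen rectangle. Its derivative is the identity, and periodicity of G removes
  d.\<close>

lemma torus_map_integrand:
  "pullback torus (\<lambda>(s, t). (cis s, cis t)) (pullback M torus_map \<omega>) (UNIV, id) x (1, 0) (0, 1) =
    pb G x (1, 0) (0, 1)"
proof -
  obtain s t where x: "x = (s, t)" by (cases x)
  let ?E = "\<lambda>(s, t). (cis s, cis t)"
  define c where "c = chart_at torus (cis s, cis t)"
  have c: "c \<in> atlas torus" "(cis s, cis t) \<in> fst c"
    unfolding c_def chart_at_def using someI_ex[OF torus_chart_exists[of s t]] by blast+
  obtain a b where ab: "c = (cis ` {a<..<a + 2 * pi} \<times> cis ` {b<..<b + 2 * pi},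
    map_prod (inv_into {a<..<a + 2 * pi} cis) (inv_into {b<..<b + 2 * pi} cis))"
    using torus_atlasE[OF c(1)] .
  let ?I = "{a<..<a + 2 * pi}" and ?J = "{b<..<b + 2 * pi}"
  let ?A = "cis ` ?I \<times> cis ` ?J" and ?\<kappa> = "map_prod (inv_into ?I cis) (inv_into ?J cis)"
  have "cis s \<in> cis ` ?I" "cis t \<in> cis ` ?J" using c(2) unfolding ab by simp_all
  then obtain s1 t1 where s1: "s1 \<in> ?I" "cis s1 = cis s" and t1: "t1 \<in> ?J" "cis t1 = cis t"
    by (metis imageE)
  obtain k l where k: "s1 = s + 2 * pi * of_int k" and l: "t1 = t + 2 * pi * of_int l"
    using s1(2) t1(2) unfolding cis_eq_iff by blast
  define d where "d = (2 * pi * of_int k, 2 * pi * of_int l)"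
  have xd: "x + d = (s1, t1)" by (simp add: x d_def k l)
  let ?N = "(\<lambda>y. y + d) -` (?I \<times> ?J)"
  have oN: "open ?N"
    by (rule open_vimage) (auto intro!: open_Times continuous_intros)
  have xN: "x \<in> ?N" using s1 t1 xd by simp
  have F: "?\<kappa> (?E y) = y + d" if y: "y \<in> ?N" for y
  proof -
    obtain u v where uv: "y = (u, v)" by (cases y)
    have "u + 2 * pi * of_int k \<in> ?I" "v + 2 * pi * of_int l \<in> ?J"
      using y by (simp_all add: uv d_def)
    from inv_into_f_f[OF inj_on_cis this(1)] inv_into_f_f[OF inj_on_cis this(2)] show ?thesis
      by (simp add: uv d_def cis_periodic)
  qed
  have "((\<lambda>y. y + d) has_derivative (\<lambda>v. v)) (at x)"
    by (auto intro!: derivative_eq_intros)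
  then have "((?\<kappa> \<circ> ?E \<circ> id) has_derivative (\<lambda>v. v)) (at x)"
    by (rule has_derivative_transform_within_open[OF _ oN xN]) (simp add: F)
  then have D: "frechet_derivative (?\<kappa> \<circ> ?E \<circ> id) (at x) = (\<lambda>v. v)"
    by (rule frechet_derivative_at[symmetric])
  have "pullback torus ?E (pullback M torus_map \<omega>) (UNIV, id) x (1, 0) (0, 1) =
      pullback M torus_map \<omega> (?A, ?\<kappa>) (?\<kappa> (?E x)) (1, 0) (0, 1)"
    unfolding pullback_def[of torus] prod.case
    using D by (simp add: Let_def x c_def[symmetric] ab)
  also have "\<dots> = pb (\<lambda>y. torus_map (inv_into ?A ?\<kappa> y)) (x + d) (1, 0) (0, 1)"
    by (simp add: F[OF xN] pb_def pullback_def comp_def)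
  also have "\<dots> = pb G (x + d) (1, 0) (0, 1)"
  proof (rule pb_cong)
    show "smooth_into M G (?I \<times> ?J)"
      by (rule smooth_into_subset[OF G]) (auto intro!: open_Times)
    show "x + d \<in> ?I \<times> ?J" using xN by simp
    fix y assume y: "y \<in> ?I \<times> ?J"
    obtain u v where uv: "y = (u, v)" by (cases y)
    show "G y = torus_map (inv_into ?A ?\<kappa> y)"
      using y unfolding uv by (subst torus_chart_inv) (simp_all add: torus_map_cis)
  qed
  also have "\<dots> = pb (\<lambda>y. G (y + d)) x (1, 0) (0, 1)"
    by (rule pb_compose[OF G, symmetric]) (auto intro!: derivative_eq_intros)
  also have "(\<lambda>y. G (y + d)) = G"
    by (auto simp: d_def per1 per2)
  finally show ?thesis .
qed

lemma torus_integral_eq_0: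
  assumes "symplectically_atoroidal M \<omega>"
  shows "integral (cbox (0, 0) (2 * pi, 2 * pi)) (\<lambda>x. pb G x (1, 0) (0, 1)) = 0"
proof -
  have "torus_integral (pullback M torus_map \<omega>) = 0"
    using assms torus_map_smooth by (simp add: symplectically_atoroidal_def)
  then show ?thesis unfolding torus_integral_def torus_map_integrand .
qed

end

text \<open>A cylinder with the same circle at both ends, constant in t there, closes up to a torus:
  t is replaced by its residue modulo 2 pi. As the integrand depends on t only, Fubini gives 2 pi c
  for its integral.\<close>

lemma (in mfd_two_form) flat_cylinder_integral_eq_0:
  fixes G :: "real \<times> real \<Rightarrow> 'm"
  assumes at: "symplectically_atoroidal M \<omega>"
    and G: "smooth_into M G UNIV"
    and per: "\<And>s t n. G (s + 2 * pi * of_int n, t) = G (s, t)"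
    and ab: "0 < a" "a < b" "b < 2 * pi"
    and flat: "\<And>s t. t \<le> a \<or> b \<le> t \<Longrightarrow> G (s, t) = G (s, 0)"
    and h: "\<And>s t. pb G (s, t) (1, 0) (0, 1) = h t"
    and c: "(h has_integral c) {0..2 * pi}"
  shows "c = 0"
proof -
  define r where "r t = t - 2 * pi * of_int \<lfloor>t / (2 * pi)\<rfloor>" for t :: real
  define H where "H = (\<lambda>(s, t). G (s, r t))"
  \<comment> \<open>The window is one period widened by the two flat collars, 2 pi - b on the left
    and a on the right; in a collar both G (s, r t) and the shifted value equal G (s, 0). Smoothness
    across the multiples of 2 pi follows, as these open windows cover the line.\<close>
  have H_eq: "H (s, t) = G (s, t - 2 * pi * of_int n)"
    if t: "2 * pi * of_int n - (2 * pi - b) < t" "t < 2 * pi * of_int n + 2 * pi + a" for s t n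
  proof -
    consider "t < 2 * pi * of_int n" | "2 * pi * of_int n \<le> t" "t < 2 * pi * of_int n + 2 * pi"
      | "2 * pi * of_int n + 2 * pi \<le> t" using not_less by blast
    then show ?thesis
    proof cases
      case 1
      have fl: "\<lfloor>t / (2 * pi)\<rfloor> = n - 1"
        using 1 t ab by (intro floor_unique) (auto simp: field_simps)
      have "r t = t - 2 * pi * of_int n + 2 * pi" unfolding r_def fl by (simp add: algebra_simps)
      then show ?thesis
        using flat[of "r t" s] flat[of "t - 2 * pi * of_int n" s] 1 t ab by (simp add: H_def)
    next
      case 2
      have "\<lfloor>t / (2 * pi)\<rfloor> = n"
        using 2 by (intro floor_unique) (auto simp: field_simps)
      then show ?thesis by (simp add: H_def r_def)
    next
      case 3
      have fl: "\<lfloor>t / (2 * pi)\<rfloor> = n + 1"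
        using 3 t ab by (intro floor_unique) (auto simp: field_simps)
      have "r t = t - 2 * pi * of_int n - 2 * pi" unfolding r_def fl by (simp add: algebra_simps)
      then show ?thesis
        using flat[of "r t" s] flat[of "t - 2 * pi * of_int n" s] 3 t ab by (simp add: H_def)
    qed
  qed
  have H: "smooth_into M H UNIV"
  proof (rule smooth_into_local[OF open_UNIV])
    fix x :: "real \<times> real"
    obtain s t where x: "x = (s, t)" by (cases x)
    define n where "n = \<lfloor>t / (2 * pi)\<rfloor>"
    have n: "2 * pi * of_int n \<le> t" "t < 2 * pi * of_int n + 2 * pi"
      using floor_correct[of "t / (2 * pi)"] unfolding n_def[symmetric]
      by (simp_all add: pos_le_divide_eq pos_divide_less_eq algebra_simps)
    let ?N = "UNIV \<times> {2 * pi * of_int n - (2 * pi - b)<..<2 * pi * of_int n + 2 * pi + a} :: (real \<times> real) set"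
    let ?d = "(0, - (2 * pi * of_int n)) :: real \<times> real"
    have o: "open ?N" by (intro open_Times) auto
    have "smooth_into M (\<lambda>y. G (y + ?d)) ?N"
      by (rule smooth_into_compose[OF G smooth_on_add[OF o smooth_on_bounded_linear[OF bounded_linear_ident o] smooth_on_const[OF o]] o])
        auto
    moreover have "H y = G (y + ?d)" if "y \<in> ?N" for y
      using that H_eq[of n "snd y" "fst y"] by (cases y) auto
    moreover have "x \<in> ?N" using x n ab by auto
    ultimately show "\<exists>N g'. x \<in> N \<and> smooth_into M g' N \<and> (\<forall>y\<in>N. H y = g' y)"
      by (intro exI[of _ ?N] exI[of _ "\<lambda>y. G (y + ?d)"] conjI ballI)
  qed
  have r_per: "r (t + 2 * pi * of_int n) = r t" for t n
  proof -
    have "(t + 2 * pi * of_int n) / (2 * pi) = t / (2 * pi) + of_int n" by (simp add: field_simps)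
    then show ?thesis unfolding r_def by (simp add: algebra_simps)
  qed
  interpret H: doubly_periodic M \<omega> H
    by unfold_locales (use H per r_per in \<open>auto simp: H_def\<close>)
  have pbH: "pb H x (1, 0) (0, 1) = h (snd x)" if "x \<in> cbox (0, 0) (2 * pi, 2 * pi)" for x
  proof -
    \<comment> \<open>This is the window for n = 0; being open around the closed square, it handles
      the boundary points too.\<close>
    let ?N = "UNIV \<times> {b - 2 * pi<..<2 * pi + a} :: (real \<times> real) set"
    have "pb H x (1, 0) (0, 1) = pb G x (1, 0) (0, 1)"
    proof (rule pb_cong[where N = ?N])
      show "smooth_into M G ?N" by (rule smooth_into_subset[OF G]) (auto intro: open_Times)
      show "x \<in> ?N" using that ab by (cases x) (auto simp: cbox_Pair_eq)
      show "G y = H y" if "y \<in> ?N" for y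
        using that H_eq[of 0 "snd y" "fst y"] by (cases y) auto
    qed
    then show ?thesis using h[of "fst x" "snd x"] by simp
  qed
  have "continuous_on UNIV (\<lambda>t. pb G (0, t) (1, 0) (0, 1))"
    by (rule continuous_on_compose2[OF pb_continuous_on[OF G]]) (auto intro!: continuous_intros)
  then have ch: "continuous_on UNIV h" by (simp add: h)
  have "integral (cbox (0, 0) (2 * pi, 2 * pi)) (\<lambda>x. h (snd x)) =
      integral (cbox (0::real) (2 * pi)) (\<lambda>s. integral (cbox 0 (2 * pi)) (\<lambda>t. h (snd (s, t))))"
    by (rule integral_prod_continuous) (auto intro!: continuous_on_compose2[OF ch] continuous_intros)
  also have "\<dots> = 2 * pi * c"
    using integral_unique[OF c] by simp
  finally have "integral (cbox (0, 0) (2 * pi, 2 * pi)) (\<lambda>x. h (snd x)) = 2 * pi * c" .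
  moreover have "integral (cbox (0, 0) (2 * pi, 2 * pi)) (\<lambda>x. pb H x (1, 0) (0, 1)) =
      integral (cbox (0, 0) (2 * pi, 2 * pi)) (\<lambda>x. h (snd x))"
    by (rule integral_cong) (rule pbH)
  ultimately show ?thesis using H.torus_integral_eq_0[OF at] by simp
qed

section \<open>The flux of the action along curves\<close>

text \<open>Integrating over the whole line leaves no limits to track under reparametrization; the
  bounded support reduces the claim to a box. The factor \<open>sgn m\<close> is the orientation:
  reversing a path negates its flux.\<close>

lemma has_integral_UNIV_affine:
  fixes f :: "real \<Rightarrow> real"
  assumes f: "(f has_integral c) UNIV" and z: "\<And>t. t \<notin> {a..b} \<Longrightarrow> f t = 0" and m: "m \<noteq> 0"
  shows "((\<lambda>t. m * f (m * t + n)) has_integral sgn m * c) UNIV"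
proof -
  have "(\<lambda>t. if t \<in> {a..b} then f t else 0) = f" using z by auto
  then have "(f has_integral c) (cbox a b)"
    using has_integral_restrict[of "{a..b}" UNIV f c] f by simp
  from has_integral_affinity[OF this m, of n]
  have "((\<lambda>t. f (m *\<^sub>R t + n)) has_integral c / \<bar>m\<bar>) ((\<lambda>x. (1 / m) *\<^sub>R x + - ((1 / m) *\<^sub>R n)) ` cbox a b)"
    by simp
  then have "((\<lambda>t. f (m *\<^sub>R t + n)) has_integral c / \<bar>m\<bar>) UNIV"
  proof (rule has_integral_on_superset)
    fix t assume t: "t \<notin> (\<lambda>x. (1 / m) *\<^sub>R x + - ((1 / m) *\<^sub>R n)) ` cbox a b"
    have "t = (1 / m) *\<^sub>R (m * t + n) + - ((1 / m) *\<^sub>R n)" using m by (simp add: field_simps)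
    then have "m * t + n \<notin> {a..b}" using t by (auto simp: image_iff)
    then show "f (m *\<^sub>R t + n) = 0" using z by simp
  qed simp
  moreover have "m * (c / \<bar>m\<bar>) = sgn m * c" using m by (simp add: sgn_if)
  ultimately show ?thesis
    using has_integral_mult_right[of "\<lambda>t. f (m *\<^sub>R t + n)" "c / \<bar>m\<bar>" UNIV m] by simp
qed

locale symplectic_circle_mfd = mfd_two_form M \<omega> + circle_mfd M \<rho>
  for M :: "('m, 'e::euclidean_space) manifold" and \<omega> \<rho> +
  assumes invariant: "\<And>z. z \<in> sphere 0 1 \<Longrightarrow> preserves_form M \<omega> (\<rho> z)"
    and nondegenerate: "nondegenerate_form M \<omega>"
    and atoroidal: "symplectically_atoroidal M \<omega>"
begin

definition sweep :: "('a::euclidean_space \<Rightarrow> 'm) \<Rightarrow> real \<times> 'a \<Rightarrow> 'm" where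
  "sweep g = (\<lambda>(s, y). \<rho> (cis s) (g y))"

text \<open>With \<open>\<xi>\<close> the vector field generating the action, this is \<open>(g\<^sup>*(\<iota>\<^sub>\<xi>\<omega>))\<^sub>y(v)\<close>.\<close>

definition flux :: "('a::euclidean_space \<Rightarrow> 'm) \<Rightarrow> 'a \<Rightarrow> 'a \<Rightarrow> real" where
  "flux g y v = pb (sweep g) (0, y) (1, 0) (0, v)"

lemma sweep_smooth:
  assumes "smooth_into M g S"
  shows "smooth_into M (sweep g) (UNIV \<times> S)"
proof -
  have o: "open (UNIV \<times> S)" by (intro open_Times open_UNIV smooth_into_open[OF assms])
  have "smooth_into M (\<lambda>x. g (snd x)) (UNIV \<times> S)"
    by (rule smooth_into_compose[OF assms smooth_on_bounded_linear[OF bounded_linear_snd o] o]) auto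
  then have "smooth_into M (\<lambda>x. \<rho> (cis (fst x)) (g (snd x))) (UNIV \<times> S)"
    by (rule action_smooth_into) (rule smooth_on_bounded_linear[OF bounded_linear_fst o])
  then show ?thesis by (simp add: sweep_def case_prod_unfold)
qed

text \<open>Rotating \<open>sweep g\<close> by s is translating its first variable by s. Since the
  rotation preserves \<omega>, the coefficients of the pullback cannot depend on s.\<close>

lemma pb_sweep_invariant:
  assumes g: "smooth_into M g S" and y: "y \<in> S"
  shows "pb (sweep g) (s, y) v w = pb (sweep g) (0, y) v w"
proof -
  have sg: "smooth_into M (sweep g) (UNIV \<times> S)" by (rule sweep_smooth[OF g])
  have y0: "(0, y) \<in> UNIV \<times> S" using y by simp
  have "pb (sweep g) (0, y) v w = pb (\<lambda>p. \<rho> (cis s) (sweep g p)) (0, y) v w"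
  proof (rule pb_preserves_form[OF invariant _ sg y0, symmetric])
    fix U \<phi> assume U: "(U, \<phi>) \<in> atlas M"
    show "smooth_into M (\<lambda>x. \<rho> (cis s) (inv_into U \<phi> x)) (\<phi> ` U)"
      by (rule action_smooth_into[OF smooth_into_chart_inv[OF U] smooth_on_const[OF chart_open[OF U]]])
  qed simp
  also have "\<dots> = pb (\<lambda>p. sweep g (p + (s, 0))) (0, y) v w"
  proof (rule pb_cong[OF _ y0])
    have o: "open ((UNIV :: real set) \<times> S)" using sg by (rule smooth_into_open)
    show "smooth_into M (\<lambda>p. sweep g (p + (s, 0))) (UNIV \<times> S)"
      by (rule smooth_into_compose[OF sg smooth_on_add[OF o smooth_on_bounded_linear[OF bounded_linear_ident o] smooth_on_const[OF o]] o])
        auto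
    fix p assume "p \<in> (UNIV :: real set) \<times> S"
    then show "sweep g (p + (s, 0)) = \<rho> (cis s) (sweep g p)"
      using smooth_into_topspace[OF g] by (cases p) (simp add: sweep_def action_mult add.commute)
  qed
  also have "\<dots> = pb (sweep g) ((0, y) + (s, 0)) v w"
    by (rule pb_compose[OF sg]) (use y in \<open>auto intro!: derivative_eq_intros\<close>)
  finally show ?thesis by simp
qed

lemma flux_cong:
  assumes g: "smooth_into M g N" and y: "y \<in> N" and eq: "\<And>z. z \<in> N \<Longrightarrow> g z = g' z"
  shows "flux g' y v = flux g y v"
  unfolding flux_def
  by (rule pb_cong[OF sweep_smooth[OF g]]) (use y eq in \<open>auto simp: sweep_def\<close>)

text \<open>This is \<open>pb_compose\<close> for the map id x h, whose derivative fixes (1, 0)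
  because h' 0 = 0.\<close>

lemma flux_compose:
  assumes g: "smooth_into M g T" and h: "(h has_derivative h') (at x)" and x: "h x \<in> T"
  shows "flux (\<lambda>x. g (h x)) x v = flux g (h x) (h' v)"
proof -
  have "((\<lambda>p. (fst p, h (snd p))) has_derivative (\<lambda>v. (fst v, h' (snd v)))) (at (0, x))"
    by (intro has_derivative_Pair has_derivative_compose[OF has_derivative_snd[OF has_derivative_ident]]
        has_derivative_fst has_derivative_ident) (simp add: h)
  from pb_compose[OF sweep_smooth[OF g] this, of "(1, 0)" "(0, v)"] x linear_0[OF has_derivative_linear[OF h]]
  show ?thesis by (simp add: flux_def sweep_def case_prod_unfold)
qed

lemma linear_flux:
  assumes g: "smooth_into M g S" and y: "y \<in> S"
  shows "linear (flux g y)"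
proof -
  have "linear (pb (sweep g) (0, y) (1, 0))"
    using pb_bilinear[OF sweep_smooth[OF g], of "(0, y)"] y by (simp add: bilinear_def)
  from linear_compose[OF _ this, of "\<lambda>v. (0, v)"] show ?thesis
    by (simp add: flux_def o_def linear_iff)
qed

lemma flux_continuous_on:
  assumes g: "smooth_into M g S"
  shows "continuous_on S (\<lambda>y. flux g y v)"
  unfolding flux_def
  by (rule continuous_on_compose2[OF pb_continuous_on[OF sweep_smooth[OF g]]]) (auto intro!: continuous_intros)

lemma smooth_into_const: "p \<in> X \<Longrightarrow> open S \<Longrightarrow> smooth_into M (\<lambda>_. p) S"
proof -
  assume p: "p \<in> X" and S: "open S"
  obtain U \<phi> where U: "(U, \<phi>) \<in> atlas M" "p \<in> U" using chart_exists[OF p] by blast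
  have "smooth_into M (\<lambda>_. inv_into U \<phi> (\<phi> p)) S"
    by (rule smooth_into_compose[OF smooth_into_chart_inv[OF U(1)] smooth_on_const[OF S] S]) (use U in auto)
  then show ?thesis using chart_inv_into[OF U] by simp
qed

lemma flux_const:
  assumes "p \<in> X"
  shows "flux (\<lambda>_. p) x v = 0"
  by (rule trans[OF flux_compose[OF smooth_into_const[OF assms open_UNIV] has_derivative_const UNIV_I]
        linear_0[OF linear_flux[OF smooth_into_const[OF assms open_UNIV] UNIV_I]]])

section \<open>Flux along paths that rest at both ends\<close>

definition flat_path :: "(real \<Rightarrow> 'm) \<Rightarrow> real \<Rightarrow> real \<Rightarrow> 'm \<Rightarrow> 'm \<Rightarrow> bool" where
  "flat_path \<gamma> a b p q \<longleftrightarrow> smooth_into M \<gamma> UNIV \<and> a < b \<and> (\<forall>t\<le>a. \<gamma> t = p) \<and> (\<forall>t\<ge>b. \<gamma> t = q)"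

text \<open>A relation, because different paths could a priori give different values; that c is
  determined by the endpoints will follow from loops having flux 0. Integration over the line is
  harmless, since a resting path has no flux.\<close>

definition path_flux :: "'m \<Rightarrow> 'm \<Rightarrow> real \<Rightarrow> bool" where
  "path_flux p q c \<longleftrightarrow> (\<exists>\<gamma> a b. flat_path \<gamma> a b p q \<and> ((\<lambda>t. flux \<gamma> t 1) has_integral c) UNIV)"

lemma flat_path_topspace: "flat_path \<gamma> a b p q \<Longrightarrow> p \<in> X \<and> q \<in> X"
  unfolding flat_path_def using smooth_into_topspace[of \<gamma> UNIV] by (metis UNIV_I order_refl)

lemma path_flux_topspace: "path_flux p q c \<Longrightarrow> p \<in> X \<and> q \<in> X"
  unfolding path_flux_def using flat_path_topspace by blast

lemma flat_path_flux_0: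
  assumes "flat_path \<gamma> a b p q" "t \<notin> {a..b}"
  shows "flux \<gamma> t 1 = 0"
proof -
  have pq: "p \<in> X" "q \<in> X" using flat_path_topspace[OF assms(1)] by auto
  show ?thesis
  proof (cases "t < a")
    case True
    have "flux \<gamma> t 1 = flux (\<lambda>_. p) t 1"
      by (rule flux_cong[of _ "{..<a}"]) (use True assms pq in \<open>auto intro: smooth_into_const simp: flat_path_def\<close>)
    then show ?thesis by (simp add: flux_const pq)
  next
    case False
    have "flux \<gamma> t 1 = flux (\<lambda>_. q) t 1"
      by (rule flux_cong[of _ "{b<..}"]) (use False assms pq in \<open>auto intro: smooth_into_const simp: flat_path_def\<close>)
    then show ?thesis by (simp add: flux_const pq)
  qed
qed

lemma flux_affine:
  assumes "smooth_into M \<gamma> UNIV"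
  shows "smooth_into M (\<lambda>t. \<gamma> (m * t + n)) UNIV" "flux (\<lambda>t. \<gamma> (m * t + n)) t 1 = m * flux \<gamma> (m * t + n) (1::real)"
proof -
  have "smooth_on (\<lambda>t::real. m * t + n) UNIV"
    using smooth_on_add[OF open_UNIV smooth_on_bounded_linear[OF bounded_linear_mult_right open_UNIV] smooth_on_const[OF open_UNIV]] .
  from smooth_into_compose[OF assms this open_UNIV] show "smooth_into M (\<lambda>t. \<gamma> (m * t + n)) UNIV" by simp
  have "((\<lambda>t. m * t + n) has_derivative (\<lambda>v. m * v)) (at t)"
    by (auto intro!: derivative_eq_intros)
  from flux_compose[OF assms this, of 1]
  have "flux (\<lambda>t. \<gamma> (m * t + n)) t 1 = flux \<gamma> (m * t + n) (m *\<^sub>R 1)" by simp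
  also have "\<dots> = m * flux \<gamma> (m * t + n) 1"
    using linear_cmul[OF linear_flux[OF assms UNIV_I], of "m * t + n" m 1] by simp
  finally show "flux (\<lambda>t. \<gamma> (m * t + n)) t 1 = m * flux \<gamma> (m * t + n) 1" .
qed

text \<open>Flux does not see the parametrization, so a path can be placed strictly inside a period
  of a torus, or away from another path before concatenation. The affine map t -> m t + n takes a, b
  to a', b'.\<close>

lemma path_flux_interval:
  assumes c: "path_flux p q c" and ab: "a < b"
  obtains \<gamma> where "flat_path \<gamma> a b p q" "((\<lambda>t. flux \<gamma> t 1) has_integral c) UNIV"
proof -
  obtain \<gamma> a' b' where \<gamma>: "flat_path \<gamma> a' b' p q" and i: "((\<lambda>t. flux \<gamma> t 1) has_integral c) UNIV"
    using c unfolding path_flux_def by blast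
  define m where "m = (b' - a') / (b - a)"
  define n where "n = a' - m * a"
  have s: "smooth_into M \<gamma> UNIV" and ab': "a' < b'" using \<gamma> by (auto simp: flat_path_def)
  have m: "m > 0" using ab ab' by (simp add: m_def)
  have ma: "m * a + n = a'" by (simp add: n_def)
  have "m * (b - a) = b' - a'" using ab by (simp add: m_def)
  then have mb: "m * b + n = b'" by (simp add: n_def algebra_simps)
  have "flat_path (\<lambda>t. \<gamma> (m * t + n)) a b p q"
    unfolding flat_path_def
  proof (intro conjI allI impI flux_affine(1)[OF s] ab)
    show "\<gamma> (m * t + n) = p" if "t \<le> a" for t
    proof -
      have "m * t \<le> m * a" using that m by simp
      then show ?thesis using \<gamma> ma by (simp add: flat_path_def)
    qed
    show "\<gamma> (m * t + n) = q" if "b \<le> t" for t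
    proof -
      have "m * b \<le> m * t" using that m by simp
      then show ?thesis using \<gamma> mb by (simp add: flat_path_def)
    qed
  qed
  moreover have "((\<lambda>t. m * flux \<gamma> (m * t + n) 1) has_integral sgn m * c) UNIV"
    by (rule has_integral_UNIV_affine[OF i]) (rule flat_path_flux_0[OF \<gamma>], assumption, use m in simp)
  then have "((\<lambda>t. flux (\<lambda>t. \<gamma> (m * t + n)) t 1) has_integral c) UNIV"
    unfolding flux_affine(2)[OF s] using m by simp
  ultimately show ?thesis by (rule that)
qed

lemma path_flux_reverse:
  assumes "path_flux p q c"
  shows "path_flux q p (- c)"
proof -
  obtain \<gamma> where \<gamma>: "flat_path \<gamma> 0 1 p q" and i: "((\<lambda>t. flux \<gamma> t 1) has_integral c) UNIV"
    using path_flux_interval[OF assms zero_less_one] .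
  have s: "smooth_into M \<gamma> UNIV" using \<gamma> by (simp add: flat_path_def)
  have "flat_path (\<lambda>t. \<gamma> ((- 1) * t + 0)) (- 1) 0 q p"
    unfolding flat_path_def using \<gamma> by (intro conjI flux_affine(1)[OF s]) (auto simp: flat_path_def)
  moreover have "((\<lambda>t. (- 1) * flux \<gamma> ((- 1) * t + 0) 1) has_integral sgn (- 1) * c) UNIV"
    by (rule has_integral_UNIV_affine[OF i]) (rule flat_path_flux_0[OF \<gamma>], assumption, simp)
  then have "((\<lambda>t. flux (\<lambda>t. \<gamma> ((- 1) * t + 0)) t 1) has_integral - c) UNIV"
    unfolding flux_affine(2)[OF s] by simp
  ultimately show ?thesis unfolding path_flux_def by blast
qed

lemma path_flux_trans:
  assumes "path_flux p q c" "path_flux q r d"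
  shows "path_flux p r (c + d)"
proof -
  obtain \<gamma> where \<gamma>: "flat_path \<gamma> 0 1 p q" and i: "((\<lambda>t. flux \<gamma> t 1) has_integral c) UNIV"
    using path_flux_interval[OF assms(1) zero_less_one] .
  obtain \<delta> where \<delta>: "flat_path \<delta> 2 3 q r" and j: "((\<lambda>t. flux \<delta> t 1) has_integral d) UNIV"
    using path_flux_interval[OF assms(2), of 2 3] by auto
  \<comment> \<open>Both paths rest at q on [1, 2], so \<eta> agrees with \<gamma> for t < 2 and
    with \<delta> for t > 1; the overlap makes it smooth. As each path has no flux outside its own
    interval, the fluxes add pointwise.\<close>
  define \<eta> where "\<eta> t = (if t < 2 then \<gamma> t else \<delta> t)" for t :: real
  have s\<gamma>: "smooth_into M \<gamma> UNIV" and s\<delta>: "smooth_into M \<delta> UNIV"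
    using \<gamma> \<delta> by (auto simp: flat_path_def)
  have 1: "smooth_into M \<gamma> {..<2}" "smooth_into M \<delta> {1<..}"
    by (rule smooth_into_subset[OF s\<gamma>] smooth_into_subset[OF s\<delta>]; simp)+
  have 2: "\<eta> t = \<gamma> t" if "t \<in> {..<2}" for t using that by (simp add: \<eta>_def)
  have 3: "\<eta> t = \<delta> t" if "t \<in> {1<..}" for t
    using that \<gamma> \<delta> by (auto simp: \<eta>_def flat_path_def)
  have "smooth_into M \<eta> UNIV"
  proof (rule smooth_into_local[OF open_UNIV])
    fix t :: real
    show "\<exists>N g'. t \<in> N \<and> smooth_into M g' N \<and> (\<forall>y\<in>N. \<eta> y = g' y)"
    proof (cases "t < 2")
      case True
      then show ?thesis using 1(1) 2 by (intro exI[of _ "{..<2}"] exI[of _ \<gamma>]) simp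
    next
      case False
      then show ?thesis using 1(2) 3 by (intro exI[of _ "{1<..}"] exI[of _ \<delta>]) simp
    qed
  qed
  then have "flat_path \<eta> 0 3 p r"
    using \<gamma> \<delta> by (auto simp: flat_path_def \<eta>_def)
  moreover have "flux \<eta> t 1 = flux \<gamma> t 1 + flux \<delta> t 1" for t
  proof (cases "t < 2")
    case True
    then have "flux \<eta> t 1 = flux \<gamma> t 1"
      using 2 by (intro flux_cong[OF 1(1)]) auto
    then show ?thesis using flat_path_flux_0[OF \<delta>, of t] True by simp
  next
    case False
    then have "flux \<eta> t 1 = flux \<delta> t 1"
      using 3 by (intro flux_cong[OF 1(2)]) auto
    then show ?thesis using flat_path_flux_0[OF \<gamma>, of t] False by simp
  qed
  then have "((\<lambda>t. flux \<eta> t 1) has_integral c + d) UNIV"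
    using has_integral_add[OF i j] by simp
  ultimately show ?thesis unfolding path_flux_def by blast
qed

lemma has_integral_flat_path:
  assumes \<gamma>: "flat_path \<gamma> a b p q" and i: "((\<lambda>t. flux \<gamma> t 1) has_integral c) UNIV" and ab: "a' \<le> a" "b \<le> b'"
  shows "((\<lambda>t. flux \<gamma> t 1) has_integral c) {a'..b'}"
proof -
  have "(\<lambda>t. if t \<in> {a'..b'} then flux \<gamma> t 1 else 0) = (\<lambda>t. flux \<gamma> t 1)"
  proof
    fix t show "(if t \<in> {a'..b'} then flux \<gamma> t 1 else 0) = flux \<gamma> t 1"
      using flat_path_flux_0[OF \<gamma>, of t] ab by (cases "t \<in> {a..b}") auto
  qed
  then show ?thesis using i has_integral_restrict[of "{a'..b'}" UNIV "\<lambda>t. flux \<gamma> t 1" c] by simp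
qed

text \<open>The return trip in \<open>path_flux_fixed_points\<close> ends at 5, and it has to end
  strictly before the period 2 pi.\<close>

lemma five_less_two_pi: "(5::real) < 2 * pi"
  using pi_gt3 by linarith

text \<open>The torus is \<open>(s, t) \<mapsto> \<rho> (cis s) (\<gamma> t)\<close>.\<close>

lemma path_flux_loop:
  assumes "path_flux p p c"
  shows "c = 0"
proof -
  obtain \<gamma> where \<gamma>: "flat_path \<gamma> 1 2 p p" and i: "((\<lambda>t. flux \<gamma> t 1) has_integral c) UNIV"
    using path_flux_interval[OF assms, of 1 2] by auto
  have s: "smooth_into M \<gamma> UNIV" using \<gamma> by (simp add: flat_path_def)
  show ?thesis
  proof (rule flat_cylinder_integral_eq_0[OF atoroidal, of "sweep \<gamma>" 1 2 "\<lambda>t. flux \<gamma> t 1"])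
    show "smooth_into M (sweep \<gamma>) UNIV" using sweep_smooth[OF s] by simp
    show "sweep \<gamma> (s + 2 * pi * of_int n, t) = sweep \<gamma> (s, t)" for s t n
      by (simp add: sweep_def cis_periodic)
    show "sweep \<gamma> (s, t) = sweep \<gamma> (s, 0)" if "t \<le> 1 \<or> 2 \<le> t" for s t
      using that \<gamma> by (auto simp: sweep_def flat_path_def)
    show "pb (sweep \<gamma>) (s, t) (1, 0) (0, 1) = flux \<gamma> t 1" for s t
      unfolding flux_def by (rule pb_sweep_invariant[OF s UNIV_I])
    show "((\<lambda>t. flux \<gamma> t 1) has_integral c) {0..2 * pi}"
      by (rule has_integral_flat_path[OF \<gamma> i]) (use five_less_two_pi in auto)
  qed (use five_less_two_pi in auto)
qed

definition fixed_point :: "'m \<Rightarrow> bool" where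
  "fixed_point p \<longleftrightarrow> (\<forall>s. \<rho> (cis s) p = p)"

text \<open>The torus rotates \<open>\<gamma>\<close> on the way from \<open>p\<close> to \<open>q\<close> and returns along \<open>\<gamma>\<close> without rotating, so that
  only the first half contributes to the integral.\<close>

lemma path_flux_fixed_points:
  assumes c: "path_flux p q c" and p: "fixed_point p" and q: "fixed_point q"
  shows "c = 0"
proof -
  obtain \<gamma> where \<gamma>: "flat_path \<gamma> 1 2 p q" and i: "((\<lambda>t. flux \<gamma> t 1) has_integral c) UNIV"
    using path_flux_interval[OF c, of 1 2] by auto
  have s\<gamma>: "smooth_into M \<gamma> UNIV" and left: "\<And>t. t \<le> 1 \<Longrightarrow> \<gamma> t = p" and right: "\<And>t. 2 \<le> t \<Longrightarrow> \<gamma> t = q"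
    using \<gamma> by (auto simp: flat_path_def)
  \<comment> \<open>The rotated trip occupies [1, 2] and the return [4, 5], where 6 - t runs
    backwards through [1, 2]. For 2 < t < 4 both formulas give q, because q is fixed, so switching
    at 3 is smooth.\<close>
  define G where "G = (\<lambda>(s, t). if t < 3 then sweep \<gamma> (s, t) else \<gamma> (6 - t))"
  define L :: "(real \<times> real) set" where "L = UNIV \<times> {..<4}"
  define R :: "(real \<times> real) set" where "R = UNIV \<times> {2<..}"
  define unrotated where "unrotated = (\<lambda>x :: real \<times> real. \<gamma> ((- 1) * snd x + 6))"
  have oL: "open L" and oR: "open R" by (auto simp: L_def R_def intro!: open_Times)
  have sL: "smooth_into M (sweep \<gamma>) L"
    by (rule smooth_into_subset[OF sweep_smooth[OF s\<gamma>] oL]) auto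
  have sR: "smooth_into M unrotated R"
    unfolding unrotated_def
    by (rule smooth_into_compose[OF flux_affine(1)[OF s\<gamma>, of "- 1" 6] smooth_on_bounded_linear[OF bounded_linear_snd oR] oR]) auto
  have GL: "sweep \<gamma> x = G x" if "x \<in> L" for x
    using that q right[of "snd x"] right[of "6 - snd x"]
    by (auto simp: G_def L_def sweep_def fixed_point_def not_less)
  have GR: "unrotated x = G x" if "x \<in> R" for x
    using that q right[of "snd x"] right[of "6 - snd x"]
    by (auto simp: G_def R_def unrotated_def sweep_def fixed_point_def)
  show ?thesis
  proof (rule flat_cylinder_integral_eq_0[OF atoroidal, of G 1 5 "\<lambda>t. flux \<gamma> t 1"])
    show "smooth_into M G UNIV"
    proof (rule smooth_into_local[OF open_UNIV])
      fix x :: "real \<times> real"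
      show "\<exists>N g'. x \<in> N \<and> smooth_into M g' N \<and> (\<forall>y\<in>N. G y = g' y)"
      proof (cases "x \<in> L")
        case True
        then show ?thesis using sL GL by (intro exI[of _ L] exI[of _ "sweep \<gamma>"]) simp
      next
        case False
        then have "x \<in> R" by (cases x) (auto simp: L_def R_def)
        then show ?thesis using sR GR by (intro exI[of _ R] exI[of _ unrotated]) simp
      qed
    qed
    show "G (s + 2 * pi * of_int n, t) = G (s, t)" for s t n
      by (simp add: G_def sweep_def cis_periodic)
    \<comment> \<open>One end is the rotated p, the other p itself; they coincide because p is
      fixed.\<close>
    show "G (s, t) = G (s, 0)" if "t \<le> 1 \<or> 5 \<le> t" for s t
      using that left[of t] left[of 0] left[of "6 - t"] p
      by (auto simp: G_def sweep_def fixed_point_def)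
    show "((\<lambda>t. flux \<gamma> t 1) has_integral c) {0..2 * pi}"
      by (rule has_integral_flat_path[OF \<gamma> i]) (use five_less_two_pi in auto)
    show "pb G (s, t) (1, 0) (0, 1) = flux \<gamma> t 1" for s t
    proof (cases "t < 4")
      case True
      have "pb G (s, t) (1, 0) (0, 1) = pb (sweep \<gamma>) (s, t) (1, 0) (0, 1)"
        by (rule pb_cong[OF sL _ GL]) (use True in \<open>auto simp: L_def\<close>)
      also have "\<dots> = flux \<gamma> t 1"
        unfolding flux_def by (rule pb_sweep_invariant[OF s\<gamma> UNIV_I])
      finally show ?thesis .
    next
      case False
      have st: "(s, t) \<in> R" using False by (simp add: R_def)
      have "pb G (s, t) (1, 0) (0, 1) = pb unrotated (s, t) (1, 0) (0, 1)"
        by (rule pb_cong[OF sR st GR])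
      \<comment> \<open>The unrotated map factors through t, so d/ds is sent to 0 and the form
        vanishes.\<close>
      also have "\<dots> = pb (\<lambda>t. \<gamma> ((- 1) * t + 6)) (snd (s, t)) (snd (1 :: real, 0)) (snd (0 :: real, 1))"
        unfolding unrotated_def
        by (rule pb_compose[OF flux_affine(1)[OF s\<gamma>, of "- 1" 6] has_derivative_snd[OF has_derivative_ident] UNIV_I])
      also have "\<dots> = 0"
        using pb_bilinear[OF flux_affine(1)[OF s\<gamma>] UNIV_I, of "- 1" 6 t]
        unfolding snd_conv by (rule bilinear_lzero)
      finally show ?thesis using flat_path_flux_0[OF \<gamma>, of t] False by simp
    qed
  qed (use five_less_two_pi in auto)
qed

end

lemma norm_scaleR_le: "u \<in> {0..1} \<Longrightarrow> norm (u *\<^sub>R w) \<le> norm w"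
  by (simp add: mult_left_le_one_le)

context symplectic_circle_mfd
begin

section \<open>The flux in a chart\<close>

text \<open>Estimates are easiest on straight segments, while flux is defined by resting paths. The
  substitution u = b t passes between the two.\<close>

lemma path_flux_segment:
  assumes U: "(U, \<phi>) \<in> atlas M" and seg: "\<And>u. u \<in> {0..1} \<Longrightarrow> x + u *\<^sub>R v \<in> \<phi> ` U"
  defines "g \<equiv> inv_into U \<phi>"
  shows "continuous_on {0..1} (\<lambda>u. flux g (x + u *\<^sub>R v) v)"
    and "path_flux (g x) (g (x + v)) (integral {0..1} (\<lambda>u. flux g (x + u *\<^sub>R v) v))"
proof -
  have g: "smooth_into M g (\<phi> ` U)" unfolding g_def by (rule smooth_into_chart_inv[OF U])
  show cont: "continuous_on {0..1} (\<lambda>u. flux g (x + u *\<^sub>R v) v)"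
    by (rule continuous_on_compose2[OF flux_continuous_on[OF g]]) (use seg in \<open>auto intro!: continuous_intros\<close>)
  obtain b :: "real \<Rightarrow> real" where b: "smooth_on b UNIV" and b0: "\<And>t. t \<le> 0 \<Longrightarrow> b t = 0"
    and b1: "\<And>t. t \<ge> 1 \<Longrightarrow> b t = 1" and b01: "\<And>t. 0 \<le> b t" "\<And>t. b t \<le> 1"
    by (rule smooth_step) blast
  define h where "h t = x + b t *\<^sub>R v" for t
  define \<gamma> where "\<gamma> = (\<lambda>t. g (h t))"
  have hU: "h t \<in> \<phi> ` U" for t unfolding h_def by (rule seg) (simp add: b01)
  have "smooth_on h UNIV"
    unfolding h_def by (intro smooth_on_add smooth_on_scaleR smooth_on_const b open_UNIV)
  then have "smooth_into M \<gamma> UNIV"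
    unfolding \<gamma>_def by (rule smooth_into_compose[OF g]) (use hU in auto)
  then have \<gamma>: "flat_path \<gamma> 0 1 (g x) (g (x + v))"
    by (auto simp: flat_path_def \<gamma>_def h_def b0 b1)
  define b' where "b' t = frechet_derivative b (at t) 1" for t
  have bd: "(b has_real_derivative b' t) (at t)" for t
  proof -
    have d: "(b has_derivative frechet_derivative b (at t)) (at t)"
      by (rule smooth_on_has_derivative[OF b UNIV_I])
    have "frechet_derivative b (at t) = (*) (b' t)"
    proof
      fix w
      show "frechet_derivative b (at t) w = b' t * w"
        using linear_cmul[OF has_derivative_linear[OF d], of w 1] by (simp add: b'_def mult.commute)
    qed
    then show ?thesis using d by (simp add: has_field_derivative_def)
  qed
  have flux: "flux \<gamma> t 1 = b' t *\<^sub>R flux g (x + b t *\<^sub>R v) v" for t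
  proof -
    have "(h has_derivative (\<lambda>w. (b' t * w) *\<^sub>R v)) (at t)"
      unfolding h_def using bd[of t] by (auto intro!: derivative_eq_intros simp: has_field_derivative_def)
    from flux_compose[OF g this hU, of 1]
    have "flux \<gamma> t 1 = flux g (h t) (b' t *\<^sub>R v)" by (simp add: \<gamma>_def)
    then show ?thesis using linear_cmul[OF linear_flux[OF g hU[of t]], of "b' t" v] by (simp add: h_def)
  qed
  let ?f = "\<lambda>u. flux g (x + u *\<^sub>R v) v"
  \<comment> \<open>The substitution rule keeps both orientations; here the second integral runs
    over the empty interval {1..0}.\<close>
  have "((\<lambda>t. b' t *\<^sub>R ?f (b t)) has_integral (integral {b 0..b 1} ?f - integral {b 1..b 0} ?f)) {0..1}"
  proof (rule has_integral_substitution_general[of "{}" 0 1 b 0 1 ?f b'])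
    show "continuous_on {0..1} b"
      using smooth_on_continuous_on[OF b] by (rule continuous_on_subset) simp
    show "(b has_real_derivative b' t) (at t within {0..1})" for t
      using bd by (rule has_field_derivative_at_within)
  qed (use cont b01 in auto)
  then have "((\<lambda>t. flux \<gamma> t 1) has_integral integral {0..1} ?f) {0..1}"
    by (simp add: flux b0 b1)
  then have "((\<lambda>t. flux \<gamma> t 1) has_integral integral {0..1} ?f) UNIV"
    by (rule has_integral_on_superset) (use flat_path_flux_0[OF \<gamma>] in auto)
  then show "path_flux (g x) (g (x + v)) (integral {0..1} ?f)"
    unfolding path_flux_def using \<gamma> by blast
qed

text \<open>The factor in front of norm v is a finite sum of continuous functions of y, hence
  bounded on compact sets.\<close>

lemma flux_bound:
  assumes g: "smooth_into M g S" and y: "y \<in> S"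
  shows "\<bar>flux g y v\<bar> \<le> (\<Sum>i\<in>Basis. \<bar>flux g y i\<bar>) * norm v"
proof -
  have lin: "linear (flux g y)" by (rule linear_flux[OF g y])
  have "flux g y v = flux g y (\<Sum>i\<in>Basis. (v \<bullet> i) *\<^sub>R i)" by (simp only: euclidean_representation)
  also have "\<dots> = (\<Sum>i\<in>Basis. (v \<bullet> i) * flux g y i)"
    by (simp add: linear_sum[OF lin] linear_cmul[OF lin] del: euclidean_representation)
  also have "\<bar>\<dots>\<bar> \<le> (\<Sum>i\<in>Basis. \<bar>(v \<bullet> i) * flux g y i\<bar>)" by (rule sum_abs)
  also have "\<dots> \<le> (\<Sum>i\<in>Basis. norm v * \<bar>flux g y i\<bar>)"
    by (intro sum_mono) (simp add: abs_mult mult_right_mono Basis_le_norm)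
  finally show ?thesis by (simp add: sum_distrib_left mult.commute)
qed

text \<open>Near q, points are joined to it by chart segments, whose flux is at most K times their
  length. This yields both the continuity of the Hamiltonian and the closedness of its
  domain.\<close>

lemma path_flux_small:
  assumes q: "q \<in> X" and \<epsilon>: "\<epsilon> > 0"
  shows "\<exists>W. openin (mtop M) W \<and> q \<in> W \<and> (\<forall>r\<in>W. \<exists>c. path_flux q r c \<and> \<bar>c\<bar> < \<epsilon>)"
proof -
  obtain U \<phi> where U: "(U, \<phi>) \<in> atlas M" "q \<in> U" using chart_exists[OF q] by blast
  define g where "g = inv_into U \<phi>"
  have g: "smooth_into M g (\<phi> ` U)" unfolding g_def by (rule smooth_into_chart_inv[OF U(1)])
  have "\<phi> q \<in> \<phi> ` U" using U by simp
  then obtain \<delta> where \<delta>: "\<delta> > 0" "cball (\<phi> q) \<delta> \<subseteq> \<phi> ` U"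
    using chart_open[OF U(1)] open_contains_cball by blast
  let ?K = "\<lambda>y. \<Sum>i\<in>Basis. \<bar>flux g y i\<bar>"
  have "continuous_on (cball (\<phi> q) \<delta>) ?K"
    by (intro continuous_on_sum continuous_on_rabs continuous_on_subset[OF flux_continuous_on[OF g] \<delta>(2)])
  then have "bounded (?K ` cball (\<phi> q) \<delta>)"
    by (intro compact_imp_bounded compact_continuous_image) auto
  then obtain K where K: "K > 0" "\<And>y. y \<in> cball (\<phi> q) \<delta> \<Longrightarrow> ?K y \<le> K"
    unfolding bounded_pos by (auto simp: abs_le_iff)
  define d where "d = min \<delta> (\<epsilon> / K)"
  have d: "d > 0" "d \<le> \<delta>" "K * d \<le> \<epsilon>" using \<delta> K \<epsilon> by (auto simp: d_def min_def field_simps)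
  let ?W = "{p \<in> U. \<phi> p \<in> ball (\<phi> q) d}"
  have "openin (subtopology (mtop M) U) {p \<in> topspace (subtopology (mtop M) U). \<phi> p \<in> ball (\<phi> q) d \<inter> \<phi> ` U}"
    by (rule openin_continuous_map_preimage[OF homeomorphic_imp_continuous_map[OF chart_homeo[OF U(1)]]])
      (simp add: openin_open_Int Int_commute)
  moreover have "{p \<in> topspace (subtopology (mtop M) U). \<phi> p \<in> ball (\<phi> q) d \<inter> \<phi> ` U} = ?W"
    using chart_subset[OF U(1)] by (auto simp: topspace_subtopology)
  ultimately have "openin (mtop M) ?W"
    using openin_trans_full[OF _ chart_openin[OF U(1)]] by simp
  moreover have "q \<in> ?W" using U d by simp
  moreover have "\<exists>c. path_flux q r c \<and> \<bar>c\<bar> < \<epsilon>" if r: "r \<in> ?W" for r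
  proof -
    define v where "v = \<phi> r - \<phi> q"
    have rU: "r \<in> U" and v: "norm v < d" using r by (auto simp: v_def dist_norm norm_minus_commute)
    have seg: "\<phi> q + u *\<^sub>R v \<in> cball (\<phi> q) \<delta>" if "u \<in> {0..1}" for u
    proof -
      have "norm (u *\<^sub>R v) \<le> norm v" using that by (rule norm_scaleR_le)
      then show ?thesis using v d by (simp add: dist_norm)
    qed
    have segU: "\<phi> q + u *\<^sub>R v \<in> \<phi> ` U" if "u \<in> {0..1}" for u using seg[OF that] \<delta> by blast
    let ?c = "integral {0..1} (\<lambda>u. flux g (\<phi> q + u *\<^sub>R v) v)"
    have "path_flux q r ?c"
      using path_flux_segment(2)[OF U(1) segU] chart_inv_into[OF U(1)] U(2) rU
      by (simp add: g_def v_def)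
    moreover have "norm ?c \<le> (K * norm v) * (1 - 0)"
    proof (rule integral_bound)
      show "continuous_on {0..1} (\<lambda>u. flux g (\<phi> q + u *\<^sub>R v) v)"
        unfolding g_def by (rule path_flux_segment(1)[OF U(1) segU])
      fix u :: real assume u: "u \<in> {0..1}"
      have "\<bar>flux g (\<phi> q + u *\<^sub>R v) v\<bar> \<le> ?K (\<phi> q + u *\<^sub>R v) * norm v"
        by (rule flux_bound[OF g segU[OF u]])
      also have "\<dots> \<le> K * norm v" by (intro mult_right_mono K(2) seg u norm_ge_zero)
      finally show "norm (flux g (\<phi> q + u *\<^sub>R v) v) \<le> K * norm v" by simp
    qed simp
    moreover have "K * norm v < K * d" using v K by simp
    ultimately show ?thesis using d by (intro exI[of _ ?c]) auto
  qed
  ultimately show ?thesis by (intro exI[of _ ?W]) blast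
qed

text \<open>\<open>path_flux_small\<close> provides some path from p to p, and
  \<open>path_flux_loop\<close> shows that its flux is 0.\<close>

lemma path_flux_refl:
  assumes "p \<in> X" shows "path_flux p p 0"
  using path_flux_small[OF assms zero_less_one] path_flux_loop by blast

text \<open>Following a direction v on which the flux has a sign changes the Hamiltonian with that
  sign. The parameter \<sigma> treats increase and decrease together.\<close>

lemma path_flux_sign:
  fixes \<sigma> :: real
  assumes U: "(U, \<phi>) \<in> atlas M" "q \<in> U" and v: "\<sigma> * flux (inv_into U \<phi>) (\<phi> q) v > 0"
  shows "\<exists>r c. path_flux q r c \<and> \<sigma> * c > 0"
proof -
  define g where "g = inv_into U \<phi>"
  have g: "smooth_into M g (\<phi> ` U)" unfolding g_def by (rule smooth_into_chart_inv[OF U(1)])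
  have q: "\<phi> q \<in> \<phi> ` U" using U by simp
  have "open (\<phi> ` U \<inter> (\<lambda>y. \<sigma> * flux g y v) -` {0<..})"
    by (rule continuous_open_preimage[OF continuous_on_mult_left[OF flux_continuous_on[OF g]] chart_open[OF U(1)]]) simp
  moreover have "\<phi> q \<in> \<phi> ` U \<inter> (\<lambda>y. \<sigma> * flux g y v) -` {0<..}" using q v by (simp add: g_def)
  ultimately obtain \<delta> where \<delta>: "\<delta> > 0" "cball (\<phi> q) \<delta> \<subseteq> \<phi> ` U \<inter> (\<lambda>y. \<sigma> * flux g y v) -` {0<..}"
    using open_contains_cball by blast
  \<comment> \<open>Scaling v by \<eta> keeps the segment in the ball where the sign persists; the
    summand 1 spares a proof that v is nonzero.\<close>
  define \<eta> where "\<eta> = \<delta> / (1 + norm v)"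
  have n: "0 < 1 + norm v" by (simp add: add_pos_nonneg)
  have \<eta>: "\<eta> > 0" using \<delta> n by (simp add: \<eta>_def)
  have "\<delta> * norm v \<le> \<delta> * (1 + norm v)" using \<delta> by (intro mult_left_mono) auto
  then have \<eta>v: "\<eta> * norm v \<le> \<delta>" using n by (simp add: \<eta>_def pos_divide_le_eq)
  have seg: "\<phi> q + u *\<^sub>R (\<eta> *\<^sub>R v) \<in> cball (\<phi> q) \<delta>" if "u \<in> {0..1}" for u
  proof -
    have "norm (u *\<^sub>R (\<eta> *\<^sub>R v)) \<le> norm (\<eta> *\<^sub>R v)"
      using that by (rule norm_scaleR_le)
    then show ?thesis using \<eta> \<eta>v by (simp add: dist_norm)
  qed
  have segU: "\<phi> q + u *\<^sub>R (\<eta> *\<^sub>R v) \<in> \<phi> ` U" and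
    pos: "\<sigma> * flux g (\<phi> q + u *\<^sub>R (\<eta> *\<^sub>R v)) v > 0" if "u \<in> {0..1}" for u
    using seg[OF that] \<delta> by auto
  let ?f = "\<lambda>u. flux g (\<phi> q + u *\<^sub>R (\<eta> *\<^sub>R v)) (\<eta> *\<^sub>R v)"
  have cont: "continuous_on {0..1} ?f"
    unfolding g_def by (rule path_flux_segment(1)[OF U(1) segU])
  have cont': "continuous_on {0..1} (\<lambda>u. \<sigma> * ?f u)" by (rule continuous_on_mult_left[OF cont])
  \<comment> \<open>The minimum over the compact interval is positive, which bounds the integral
    strictly away from 0.\<close>
  obtain u0 where u0: "u0 \<in> {0..1}" "\<And>u. u \<in> {0..1} \<Longrightarrow> \<sigma> * ?f u0 \<le> \<sigma> * ?f u"
    using continuous_attains_inf[OF compact_Icc _ cont'] by auto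
  have "0 < \<eta> * (\<sigma> * flux g (\<phi> q + u0 *\<^sub>R (\<eta> *\<^sub>R v)) v)"
    using pos[OF u0(1)] \<eta> by simp
  also have "\<dots> = \<sigma> * ?f u0"
    using linear_cmul[OF linear_flux[OF g segU[OF u0(1)]], of \<eta> v] by simp
  also have "\<dots> = integral {0..1::real} (\<lambda>_. \<sigma> * ?f u0)" by simp
  also have "\<dots> \<le> integral {0..1} (\<lambda>u. \<sigma> * ?f u)"
    by (intro integral_le integrable_continuous_real cont' continuous_on_const u0(2))
  also have "\<dots> = \<sigma> * integral {0..1} ?f" by simp
  finally have "\<sigma> * integral {0..1} ?f > 0" .
  then show ?thesis
    using path_flux_segment(2)[OF U(1) segU] chart_inv_into[OF U] unfolding g_def by auto
qed

section \<open>Zeros of the flux are fixed points\<close>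

lemma action_curve_smooth: "q \<in> X \<Longrightarrow> smooth_into M (\<lambda>s. \<rho> (cis s) q) (UNIV :: real set)"
  by (rule action_smooth_into[OF smooth_into_const[OF _ open_UNIV] smooth_on_bounded_linear[OF bounded_linear_ident open_UNIV]])

text \<open>For the derivative D of the sweep in the chart, D (1, 0) is the generating field at q
  and D (0, v) = v. Vanishing flux says that D (1, 0) pairs to 0 with every v, so nondegeneracy
  kills it.\<close>

lemma action_curve_derivative_0:
  assumes U: "(U, \<phi>) \<in> atlas M" "q \<in> U" and crit: "\<And>v. flux (inv_into U \<phi>) (\<phi> q) v = 0"
  shows "((\<lambda>s. \<phi> (\<rho> (cis s) q)) has_derivative (\<lambda>_. 0)) (at 0)"
proof -
  define g where "g = inv_into U \<phi>"
  have g: "smooth_into M g (\<phi> ` U)" unfolding g_def by (rule smooth_into_chart_inv[OF U(1)])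
  have q: "\<phi> q \<in> \<phi> ` U" using U by simp
  have gq: "g (\<phi> q) = q" using chart_inv_into[OF U] by (simp add: g_def)
  have qX: "q \<in> X" using U chart_subset by blast
  have fg: "\<phi> (g y) = y" if "y \<in> \<phi> ` U" for y unfolding g_def by (rule f_inv_into_f[OF that])
  have sw0: "sweep g (0, y) = g y" if "y \<in> \<phi> ` U" for y
    using smooth_into_topspace[OF g that] by (simp add: sweep_def action_one)
  define D where "D = frechet_derivative (\<phi> \<circ> sweep g) (at (0, \<phi> q))"
  have x: "(0, \<phi> q) \<in> UNIV \<times> \<phi> ` U" "sweep g (0, \<phi> q) \<in> U"
    using q gq U(2) sw0 by auto
  have D: "((\<phi> \<circ> sweep g) has_derivative D) (at (0, \<phi> q))"
    unfolding D_def by (rule smooth_into_chart_has_derivative[OF sweep_smooth[OF g] x(1) U(1) x(2)])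
  \<comment> \<open>At s = 0 the action is the identity, so the sweep restricts to the inverse chart
    there.\<close>
  have D2: "D (0, v) = v" for v
  proof -
    have "((\<lambda>y. (0 :: real, y)) has_derivative (\<lambda>v. (0, v))) (at (\<phi> q))"
      by (auto intro!: derivative_eq_intros)
    from has_derivative_compose[OF this D]
    have "((\<lambda>y. (\<phi> \<circ> sweep g) (0, y)) has_derivative (\<lambda>v. D (0, v))) (at (\<phi> q))" .
    then have "((\<lambda>y. y) has_derivative (\<lambda>v. D (0, v))) (at (\<phi> q))"
      by (rule has_derivative_transform_within_open[OF _ chart_open[OF U(1)] q])
        (simp add: sw0 fg)
    from has_derivative_unique[OF this has_derivative_ident] show ?thesis by metis
  qed
  have "\<omega> (U, \<phi>) (\<phi> q) (D (1, 0)) v = 0" for v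
  proof -
    have "flux g (\<phi> q) v = \<omega> (U, \<phi>) (\<phi> (sweep g (0, \<phi> q))) (D (1, 0)) (D (0, v))"
      unfolding flux_def D_def by (rule pb_chart[OF sweep_smooth[OF g] x(1) U(1) x(2)])
    then show ?thesis using crit[of v] sw0[OF q] gq D2 by (simp add: g_def)
  qed
  then have D1: "D (1, 0) = 0"
    using nondegenerate U unfolding nondegenerate_form_def by fastforce
  have "((\<lambda>s. (s, \<phi> q)) has_derivative (\<lambda>s. (s, 0))) (at (0 :: real))"
    by (auto intro!: derivative_eq_intros)
  from has_derivative_compose[OF this D]
  have "((\<lambda>s. \<phi> (\<rho> (cis s) q)) has_derivative (\<lambda>s. D (s, 0))) (at 0)"
    by (simp add: sweep_def gq)
  moreover have "D (s, 0) = 0" for s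
    using linear_cmul[OF has_derivative_linear[OF D], of s "(1, 0)"] D1 by simp
  ultimately show ?thesis by simp
qed

text \<open>The group law c(s) = \<rho> (cis s0) (c(s - s0)) carries the zero velocity at time 0 to
  every time s0. The orbit is then locally constant in charts, hence constant on the connected
  line.\<close>

lemma critical_imp_fixed_point:
  assumes U: "(U, \<phi>) \<in> atlas M" "q \<in> U" and crit: "\<And>v. flux (inv_into U \<phi>) (\<phi> q) v = 0"
  shows "fixed_point q"
proof -
  define g where "g = inv_into U \<phi>"
  have gq: "g (\<phi> q) = q" using chart_inv_into[OF U] by (simp add: g_def)
  have qX: "q \<in> X" using U chart_subset by blast
  define c where "c s = \<rho> (cis s) q" for s
  have c: "smooth_into M c UNIV" unfolding c_def by (rule action_curve_smooth[OF qX])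
  have c0: "c 0 = q" using qX by (simp add: c_def action_one)
  have deriv: "((\<psi> \<circ> c) has_derivative (\<lambda>_. 0)) (at s0)"
    if V: "(V, \<psi>) \<in> atlas M" "c s0 \<in> V" for V \<psi> s0
  proof -
    have a: "smooth_into M (\<lambda>x. \<rho> (cis s0) (g x)) (\<phi> ` U)"
      unfolding g_def by (rule action_smooth_into[OF smooth_into_chart_inv[OF U(1)] smooth_on_const[OF chart_open[OF U(1)]]])
    let ?F = "\<psi> \<circ> (\<lambda>x. \<rho> (cis s0) (g x))"
    have F: "(?F has_derivative frechet_derivative ?F (at (\<phi> q))) (at (\<phi> q))"
      by (rule smooth_into_chart_has_derivative[OF a]) (use U V gq in \<open>auto simp: c_def\<close>)
    have "((\<lambda>s. s - s0) has_derivative (\<lambda>s. s)) (at s0)" by (auto intro!: derivative_eq_intros)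
    moreover have "((\<lambda>s. \<phi> (c s)) has_derivative (\<lambda>_. 0)) (at (s0 - s0))"
      using action_curve_derivative_0[OF U crit] by (simp add: c_def)
    ultimately have "((\<lambda>s. \<phi> (c (s - s0))) has_derivative (\<lambda>_. 0)) (at s0)"
      by (rule has_derivative_compose)
    moreover have "(?F has_derivative frechet_derivative ?F (at (\<phi> q))) (at (\<phi> (c (s0 - s0))))"
      using F c0 by simp
    ultimately have "((\<lambda>s. ?F (\<phi> (c (s - s0)))) has_derivative (\<lambda>_. frechet_derivative ?F (at (\<phi> q)) 0)) (at s0)"
      by (rule has_derivative_compose)
    then have 1: "((\<lambda>s. ?F (\<phi> (c (s - s0)))) has_derivative (\<lambda>_. 0)) (at s0)"
      using linear_0[OF has_derivative_linear[OF F]] by simp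
    let ?N = "(\<lambda>s. s - s0) -` (UNIV \<inter> c -` U)"
    have oN: "open ?N"
      by (intro open_vimage smooth_into_chart(1)[OF c U(1)]) (auto intro!: continuous_intros)
    show ?thesis
    proof (rule has_derivative_transform_within_open[OF 1 oN])
      show "s0 \<in> ?N" using c0 U by simp
      fix s assume "s \<in> ?N"
      then have "g (\<phi> (c (s - s0))) = c (s - s0)"
        using chart_inv_into[OF U(1)] by (simp add: g_def)
      then show "?F (\<phi> (c (s - s0))) = (\<psi> \<circ> c) s"
        using action_mult[OF qX, of s0 "s - s0"] by (simp add: c_def)
    qed
  qed
  have "c s = c 0" for s
  proof (rule connected_local_const[OF connected_UNIV UNIV_I UNIV_I], rule ballI)
    fix s0 :: real
    have "c s0 \<in> X" by (rule smooth_into_topspace[OF c UNIV_I])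
    then obtain V \<psi> where V: "(V, \<psi>) \<in> atlas M" "c s0 \<in> V" using chart_exists by blast
    obtain e where e: "e > 0" "ball s0 e \<subseteq> UNIV \<inter> c -` V"
      by (rule openE[OF smooth_into_chart(1)[OF c V(1)], of s0]) (use V(2) in auto)
    have "\<exists>k. \<forall>s\<in>ball s0 e. (\<psi> \<circ> c) s = k"
    proof (rule has_derivative_zero_constant)
      fix s assume "s \<in> ball s0 e"
      then have "c s \<in> V" using e by blast
      then show "((\<psi> \<circ> c) has_derivative (\<lambda>_. 0)) (at s within ball s0 e)"
        by (rule has_derivative_at_withinI[OF deriv[OF V(1)]])
    qed simp
    then obtain k where k: "\<And>s. s \<in> ball s0 e \<Longrightarrow> \<psi> (c s) = k" by auto
    have "c s0 = c s" if s: "s \<in> ball s0 e" for s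
    proof -
      have "c s \<in> V" using e s by blast
      moreover have "\<psi> (c s0) = \<psi> (c s)" using k[OF s] k[of s0] e by simp
      ultimately show ?thesis using chart_inj[OF V(1)] V(2) by (simp add: inj_on_eq_iff)
    qed
    then show "\<forall>\<^sub>F s in at s0. c s0 = c s"
      unfolding eventually_at using e by (intro exI[of _ e]) (auto simp: dist_commute)
  qed
  then show ?thesis unfolding fixed_point_def using c0 by (simp add: c_def)
qed

text \<open>\<sigma> = 1 serves maxima and \<sigma> = -1 minima. A linear functional whose
  \<sigma>-multiple is nonpositive on both v and - v vanishes.\<close>

lemma path_flux_sign_imp_fixed_point:
  fixes \<sigma> :: real
  assumes q: "q \<in> X" and \<sigma>: "\<sigma> \<noteq> 0" "\<And>r c. path_flux q r c \<Longrightarrow> \<sigma> * c \<le> 0"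
  shows "fixed_point q"
proof -
  obtain U \<phi> where U: "(U, \<phi>) \<in> atlas M" "q \<in> U" using chart_exists[OF q] by blast
  have lin: "linear (flux (inv_into U \<phi>) (\<phi> q))"
    by (rule linear_flux[OF smooth_into_chart_inv[OF U(1)]]) (use U in auto)
  have le: "\<sigma> * flux (inv_into U \<phi>) (\<phi> q) v \<le> 0" for v
    using path_flux_sign[OF U, of \<sigma> v] \<sigma>(2) by (metis not_less)
  have "flux (inv_into U \<phi>) (\<phi> q) v = 0" for v
    using le[of v] le[of "- v"] linear_neg[OF lin, of v] \<sigma>(1)
    by (simp add: antisym)
  then show ?thesis by (rule critical_imp_fixed_point[OF U])
qed

section \<open>The Hamiltonian\<close>

lemma all_fixed_points:
  assumes compact: "compact_space (mtop M)" and p: "p \<in> X"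
  shows "fixed_point p"
proof -
  \<comment> \<open>R plays the component of p and H the Hamiltonian on it, normalized by H p =
    0.\<close>
  define R where "R = {r. \<exists>c. path_flux p r c}"
  define H where "H r = (THE c. path_flux p r c)" for r
  have H_eq: "H r = c" if "path_flux p r c" for r c
    unfolding H_def
  proof (rule the_equality[of "path_flux p r" c, OF that])
    fix d assume "path_flux p r d"
    from path_flux_loop[OF path_flux_trans[OF this path_flux_reverse[OF that]]] show "d = c" by simp
  qed
  have H: "path_flux p r (H r)" if "r \<in> R" for r
    using that H_eq by (auto simp: R_def)
  have H_diff: "H r = H q + c" "r \<in> R" if "q \<in> R" "path_flux q r c" for q r c
    using path_flux_trans[OF H[OF that(1)] that(2)] H_eq by (auto simp: R_def)
  have RX: "R \<subseteq> X" using path_flux_topspace by (auto simp: R_def)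
  have pR: "p \<in> R" and Hp: "H p = 0"
    using path_flux_refl[OF p] H_eq by (auto simp: R_def)
  \<comment> \<open>If a point near q were reachable from p, reversing the short path from q to it
    would make q reachable as well.\<close>
  have "openin (mtop M) (X - R)"
  proof (subst openin_subopen, rule ballI)
    fix q assume q: "q \<in> X - R"
    obtain W where W: "openin (mtop M) W" "q \<in> W" "\<And>r. r \<in> W \<Longrightarrow> \<exists>c. path_flux q r c"
      using path_flux_small[of q 1] q by (metis DiffD1 zero_less_one)
    have "W \<subseteq> X - R"
    proof
      fix r assume r: "r \<in> W"
      then obtain c where c: "path_flux q r c" using W(3) by blast
      have "r \<notin> R" using H_diff(2)[OF _ path_flux_reverse[OF c]] q by blast
      then show "r \<in> X - R" using path_flux_topspace[OF c] by blast
    qed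
    then show "\<exists>T. openin (mtop M) T \<and> q \<in> T \<and> T \<subseteq> X - R" using W by blast
  qed
  then have "closedin (mtop M) R" using RX by (simp add: closedin_def)
  then have "compactin (mtop M) R" by (rule closedin_compact_space[OF compact])
  then have cR: "compactin (subtopology (mtop M) R) R" by (simp add: compactin_subtopology)
  have "continuous_map (subtopology (mtop M) R) euclideanreal H"
    unfolding continuous_map_def
  proof (intro conjI allI impI)
    fix T :: "real set" assume T: "openin euclideanreal T"
    let ?P = "{r \<in> topspace (subtopology (mtop M) R). H r \<in> T}"
    have "\<exists>W. openin (subtopology (mtop M) R) W \<and> q \<in> W \<and> W \<subseteq> ?P" if q: "q \<in> ?P" for q
    proof -
      have qR: "q \<in> R" "q \<in> X" using q by auto
      obtain e where e: "e > 0" "ball (H q) e \<subseteq> T"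
        using T q open_contains_ball[of T] by auto
      obtain W where W: "openin (mtop M) W" "q \<in> W" "\<And>r. r \<in> W \<Longrightarrow> \<exists>c. path_flux q r c \<and> \<bar>c\<bar> < e"
        using path_flux_small[OF qR(2) e(1)] by blast
      have "W \<inter> R \<subseteq> ?P"
      proof
        fix r assume r: "r \<in> W \<inter> R"
        then obtain c where c: "path_flux q r c" "\<bar>c\<bar> < e" using W(3) by blast
        have "H r \<in> ball (H q) e" using H_diff(1)[OF qR(1) c(1)] c(2) by (simp add: dist_real_def)
        then show "r \<in> ?P" using e r RX by auto
      qed
      moreover have "openin (subtopology (mtop M) R) (W \<inter> R)"
        using W(1) by (auto simp: openin_subtopology)
      ultimately show ?thesis using W(2) qR by blast
    qed
    then show "openin (subtopology (mtop M) R) ?P" by (subst openin_subopen) blast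
  qed auto
  from image_compactin[OF cR this] have "compact (H ` R)" by simp
  moreover have "H ` R \<noteq> {}" using pR by blast
  ultimately obtain q q' where q: "q \<in> R" "\<And>r. r \<in> R \<Longrightarrow> H r \<le> H q"
    and q': "q' \<in> R" "\<And>r. r \<in> R \<Longrightarrow> H q' \<le> H r"
    using compact_attains_sup[of "H ` R"] compact_attains_inf[of "H ` R"] by blast
  have "fixed_point q"
  proof (rule path_flux_sign_imp_fixed_point[of _ 1])
    show "1 * c \<le> 0" if "path_flux q r c" for r c
      using q(2)[OF H_diff(2)[OF q(1) that]] H_diff(1)[OF q(1) that] by simp
  qed (use q RX in auto)
  moreover have "fixed_point q'"
  proof (rule path_flux_sign_imp_fixed_point[of _ "- 1"])
    show "- 1 * c \<le> 0" if "path_flux q' r c" for r c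
      using q'(2)[OF H_diff(2)[OF q'(1) that]] H_diff(1)[OF q'(1) that] by simp
  qed (use q' RX in auto)
  moreover have "path_flux q q' (- H q + H q')"
    by (rule path_flux_trans[OF path_flux_reverse[OF H[OF q(1)]] H[OF q'(1)]])
  ultimately have eq: "H q' = H q" using path_flux_fixed_points by fastforce
  \<comment> \<open>Any path from p to r has flux H r \<le> H q = H q' \<le> H p = 0, so p is itself
    a maximum and the criterion applies to it directly.\<close>
  show ?thesis
  proof (rule path_flux_sign_imp_fixed_point[OF p, of 1])
    show "1 * c \<le> 0" if c: "path_flux p r c" for r c
    proof -
      have "r \<in> R" using c by (auto simp: R_def)
      then show ?thesis using q(2)[of r] q'(2)[OF pR] eq H_eq[OF c] Hp by simp
    qed
  qed simp
qed

end

theorem proposition1p3: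
  fixes M :: "('m, 'e::euclidean_space) manifold"
    and \<omega> :: "('m, 'e) two_form"
  assumes "closed_manifold M"
    and "symplectic_manifold M \<omega>"
    and "symplectically_atoroidal M \<omega>"
  shows "\<not> (\<exists>\<rho>. symplectic_circle_action M \<omega> \<rho> \<and> \<not> trivial_action M \<rho>)"
proof -
  have "trivial_action M \<rho>" if \<rho>: "symplectic_circle_action M \<omega> \<rho>" for \<rho>
  proof -
    interpret symplectic_circle_mfd M \<omega> \<rho>
      by unfold_locales
        (use assms \<rho> in \<open>auto simp: symplectic_manifold_def symplectic_circle_action_def\<close>)
    show ?thesis
      unfolding trivial_action_def
    proof (intro ballI)
      fix z p assume z: "z \<in> sphere (0 :: complex) 1" and p: "p \<in> topspace (mtop M)"
      have "fixed_point p"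
        using all_fixed_points p assms(1) by (simp add: closed_manifold_def)
      moreover have "norm z = 1" using z by simp
      then have "z = cis (Arg z)"
        using cis_Arg[of z] by (cases "z = 0") (simp_all add: sgn_eq)
      ultimately show "\<rho> z p = p" unfolding fixed_point_def by metis
    qed
  qed
  then show ?thesis by blast
qed

end
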